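(* Let $(X,\omega_1,\omega_2,\mathbf{g})$ be an almost $2$-Kähler manifold with dualizing form $\omega_D$, and let $\nabla$ be the Levi-Civita connection of $\mathbf{g}$. If $\nabla\omega_1=\nabla\omega_2=0$, then $\nabla\omega_D=0$, and hence $(X,\omega_1,\omega_2,\mathbf{g})$ is weakly self-dual.
   Context: For a $2$-form $\alpha$, $\alpha^\perp$ denotes the space (distribution) of vectors $v$ with $\iota_v\alpha=0$. A polysymplectic structure on a vector space $V$ of dimension $n(s+1)$ is given by $\omega_1,\dots,\omega_s\in\Lambda^2V^*$ for which there is a basis $v_1,\dots,v_n,w^1_1,\dots,w^s_n$ of $V$ (called a standard polysymplectic basis) with $\omega_j=\sum_{i=1}^n v_i^*\wedge (w_i^j)^*$ for all $j$. A polysymplectic manifold is a smooth manifold $X$ of dimension $n(s+1)$ with smooth $2$-forms $\omega_1,\dots,\omega_s$ that are closed, induce a polysymplectic structure on each $T_pX$, and are such that the distribution $\sum_j\omega_j^\perp$ is integrable. A Riemannian metric $\mathbf{g}$ is compatible with the polysymplectic structure if every $T_pX$ has a standard polysymplectic basis that is $\mathbf{g}$-orthonormal; then $(X,\omega_1,\dots,\omega_s,\mathbf{g})$ is an almost $s$-Kähler manifold. On an almost $2$-Kähler manifold the dualizing form $\omega_D$ is the (well defined) $2$-form given at $p$ by $\sum_{i=1}^n (w_i^1)^*\wedge(w_i^2)^*$ for any orthonormal standard polysymplectic basis $v_1,\dots,v_n,w^1_1,\dots,w^2_n$ of $T_pX$. The manifold is weakly self-dual if $d\omega_D=0$. *)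

theory Defs
  imports "HOL-Analysis.Analysis" "HOL-Library.Function_Algebras"
begin

section \<open>Smooth maps between open subsets of normed spaces\<close>

text \<open>Both notions are meant for open sets only.\<close>

primrec Ck_on ::
  "nat \<Rightarrow> 'e::real_normed_vector set \<Rightarrow> ('e \<Rightarrow> 'f::real_normed_vector) \<Rightarrow> bool" where
  "Ck_on 0 S f \<longleftrightarrow> continuous_on S f"
| "Ck_on (Suc k) S f \<longleftrightarrow>
     (\<forall>x\<in>S. f differentiable (at x)) \<and>
     (\<forall>v. Ck_on k S (\<lambda>x. frechet_derivative f (at x) v))"

definition smooth_on ::
  "'e::real_normed_vector set \<Rightarrow> ('e \<Rightarrow> 'f::real_normed_vector) \<Rightarrow> bool" where
  "smooth_on S f \<longleftrightarrow> (\<forall>k. Ck_on k S f)"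


section \<open>Smooth manifolds\<close>

text \<open>A chart is a pair of its domain and its coordinate map; the values of the coordinate map
  outside the domain are irrelevant. The model space is an arbitrary Euclidean space.\<close>

type_synonym ('a, 'e) chart = "'a set \<times> ('a \<Rightarrow> 'e)"

abbreviation chart_im :: "('a, 'e) chart \<Rightarrow> 'e set" where
  "chart_im c \<equiv> snd c ` fst c"

abbreviation chart_inv :: "('a, 'e) chart \<Rightarrow> 'e \<Rightarrow> 'a" where
  "chart_inv c \<equiv> inv_into (fst c) (snd c)"

definition is_chart :: "'a topology \<Rightarrow> ('a, 'e::euclidean_space) chart \<Rightarrow> bool" where
  "is_chart X c \<longleftrightarrow> openin X (fst c) \<and> open (chart_im c) \<and>
     homeomorphic_map (subtopology X (fst c)) (top_of_set (chart_im c)) (snd c)"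

definition smoothly_compatible ::
  "('a, 'e::euclidean_space) chart \<Rightarrow> ('a, 'e) chart \<Rightarrow> bool" where
  "smoothly_compatible c d \<longleftrightarrow>
     smooth_on (snd c ` (fst c \<inter> fst d)) (snd d \<circ> chart_inv c) \<and>
     smooth_on (snd d ` (fst c \<inter> fst d)) (snd c \<circ> chart_inv d)"

text \<open>The smooth structure is a maximal atlas.\<close>

definition smooth_manifold :: "'a topology \<Rightarrow> ('a, 'e::euclidean_space) chart set \<Rightarrow> bool" where
  "smooth_manifold X A \<longleftrightarrow>
     Hausdorff_space X \<and> second_countable X \<and>
     (\<forall>c\<in>A. is_chart X c) \<and>
     (\<Union>c\<in>A. fst c) = topspace X \<and>
     (\<forall>c\<in>A. \<forall>d\<in>A. smoothly_compatible c d) \<and>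
     (\<forall>c. is_chart X c \<and> (\<forall>d\<in>A. smoothly_compatible c d) \<longrightarrow> c \<in> A)"

definition charts_at :: "('a, 'e) chart set \<Rightarrow> 'a \<Rightarrow> ('a, 'e) chart set" where
  "charts_at A p = {c \<in> A. p \<in> fst c}"

definition smooth_fun :: "('a, 'e::euclidean_space) chart set \<Rightarrow> ('a \<Rightarrow> real) \<Rightarrow> bool" where
  "smooth_fun A f \<longleftrightarrow> (\<forall>c\<in>A. smooth_on (chart_im c) (f \<circ> chart_inv c))"


section \<open>Tangent vectors and vector fields\<close>

text \<open>The pointwise vector space structure on functions; the additive part is provided
  by HOL-Library.\<close>

instantiation "fun" :: (type, real_vector) real_vector
begin
definition scaleR_fun :: "real \<Rightarrow> ('a \<Rightarrow> 'b) \<Rightarrow> 'a \<Rightarrow> 'b" where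
  "scaleR_fun r f = (\<lambda>x. r *\<^sub>R f x)"
instance
  by standard (auto simp: scaleR_fun_def fun_eq_iff scaleR_add_right scaleR_add_left)
end

text \<open>A tangent vector at \<open>p\<close> assigns to every chart around \<open>p\<close> a coordinate vector such that
  coordinate vectors in different charts are related by the derivative of the transition map.
  The value at all other charts is fixed to be zero; in particular the tangent space at a
  point outside of the manifold is \<open>{0}\<close>, and two vector fields that agree
  on the manifold are equal.\<close>

type_synonym ('a, 'e) tvec = "('a, 'e) chart \<Rightarrow> 'e"
type_synonym ('a, 'e) vfield = "'a \<Rightarrow> ('a, 'e) tvec"
type_synonym ('a, 'e) bform = "('a, 'e) tvec \<Rightarrow> ('a, 'e) tvec \<Rightarrow> real"

definition tangent_space ::
  "('a, 'e::euclidean_space) chart set \<Rightarrow> 'a \<Rightarrow> ('a, 'e) tvec set" where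
  "tangent_space A p =
     {v. (\<forall>c. c \<notin> charts_at A p \<longrightarrow> v c = 0) \<and>
         (\<forall>c\<in>charts_at A p. \<forall>d\<in>charts_at A p.
            v d = frechet_derivative (snd d \<circ> chart_inv c) (at (snd c p)) (v c))}"

text \<open>The tangent vector at \<open>p\<close> with coordinate vector \<open>a\<close> in the chart \<open>c\<close>.\<close>

definition coord_tvec ::
  "('a, 'e::euclidean_space) chart set \<Rightarrow> ('a, 'e) chart \<Rightarrow> 'a \<Rightarrow> 'e \<Rightarrow> ('a, 'e) tvec" where
  "coord_tvec A c p a =
     (\<lambda>d. if d \<in> charts_at A p
          then frechet_derivative (snd d \<circ> chart_inv c) (at (snd c p)) a else 0)"

definition smooth_vfield :: "('a, 'e::euclidean_space) chart set \<Rightarrow> ('a, 'e) vfield \<Rightarrow> bool" where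
  "smooth_vfield A Y \<longleftrightarrow>
     (\<forall>p. Y p \<in> tangent_space A p) \<and>
     (\<forall>c\<in>A. smooth_on (chart_im c) (\<lambda>x. Y (chart_inv c x) c))"

text \<open>The derivative of \<open>f\<close> at \<open>p\<close> in direction of a tangent vector \<open>v\<close> at \<open>p\<close>, which does not
  depend on the choice of the chart.\<close>

definition dir_deriv ::
  "('a, 'e::euclidean_space) chart set \<Rightarrow> 'a \<Rightarrow> ('a, 'e) tvec \<Rightarrow> ('a \<Rightarrow> real) \<Rightarrow> real" where
  "dir_deriv A p v f =
     (let c = (SOME c. c \<in> charts_at A p)
      in frechet_derivative (f \<circ> chart_inv c) (at (snd c p)) (v c))"

definition lie_bracket ::
  "('a, 'e::euclidean_space) chart set \<Rightarrow> ('a, 'e) vfield \<Rightarrow> ('a, 'e) vfield \<Rightarrow> ('a, 'e) vfield"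
  where
  "lie_bracket A Y Z = (\<lambda>p c.
     if c \<in> charts_at A p
     then frechet_derivative (\<lambda>x. Z (chart_inv c x) c) (at (snd c p)) (Y p c)
        - frechet_derivative (\<lambda>x. Y (chart_inv c x) c) (at (snd c p)) (Z p c)
     else 0)"


section \<open>Forms and metrics\<close>

definition bilinear_on :: "'v::real_vector set \<Rightarrow> ('v \<Rightarrow> 'v \<Rightarrow> real) \<Rightarrow> bool" where
  "bilinear_on T \<beta> \<longleftrightarrow>
     (\<forall>u\<in>T. \<forall>v\<in>T. \<forall>w\<in>T. \<forall>r.
        \<beta> (r *\<^sub>R u + v) w = r * \<beta> u w + \<beta> v w \<and>
        \<beta> w (r *\<^sub>R u + v) = r * \<beta> w u + \<beta> w v)"

definition alternating_on :: "'v set \<Rightarrow> ('v \<Rightarrow> 'v \<Rightarrow> real) \<Rightarrow> bool" where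
  "alternating_on T \<beta> \<longleftrightarrow> (\<forall>u\<in>T. \<beta> u u = 0)"

definition smooth_bilinear_field ::
  "'a topology \<Rightarrow> ('a, 'e::euclidean_space) chart set \<Rightarrow> ('a \<Rightarrow> ('a, 'e) bform) \<Rightarrow> bool" where
  "smooth_bilinear_field X A \<beta> \<longleftrightarrow>
     (\<forall>p\<in>topspace X. bilinear_on (tangent_space A p) (\<beta> p)) \<and>
     (\<forall>c\<in>A. \<forall>a b. smooth_on (chart_im c)
        (\<lambda>x. let p = chart_inv c x in \<beta> p (coord_tvec A c p a) (coord_tvec A c p b)))"

definition two_form ::
  "'a topology \<Rightarrow> ('a, 'e::euclidean_space) chart set \<Rightarrow> ('a \<Rightarrow> ('a, 'e) bform) \<Rightarrow> bool" where
  "two_form X A \<omega> \<longleftrightarrow> smooth_bilinear_field X A \<omega> \<and>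
     (\<forall>p\<in>topspace X. alternating_on (tangent_space A p) (\<omega> p))"

definition riemannian_metric ::
  "'a topology \<Rightarrow> ('a, 'e::euclidean_space) chart set \<Rightarrow> ('a \<Rightarrow> ('a, 'e) bform) \<Rightarrow> bool" where
  "riemannian_metric X A g \<longleftrightarrow> smooth_bilinear_field X A g \<and>
     (\<forall>p\<in>topspace X.
        (\<forall>u\<in>tangent_space A p. \<forall>v\<in>tangent_space A p. g p u v = g p v u) \<and>
        (\<forall>u\<in>tangent_space A p. u \<noteq> 0 \<longrightarrow> g p u u > 0))"

text \<open>The exterior derivative of a 2-form, evaluated on three vector fields
  (the invariant formula).\<close>

definition ext_deriv ::
  "('a, 'e::euclidean_space) chart set \<Rightarrow> ('a \<Rightarrow> ('a, 'e) bform) \<Rightarrow>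
   ('a, 'e) vfield \<Rightarrow> ('a, 'e) vfield \<Rightarrow> ('a, 'e) vfield \<Rightarrow> 'a \<Rightarrow> real" where
  "ext_deriv A \<omega> Y Z W p =
     dir_deriv A p (Y p) (\<lambda>q. \<omega> q (Z q) (W q))
   - dir_deriv A p (Z p) (\<lambda>q. \<omega> q (Y q) (W q))
   + dir_deriv A p (W p) (\<lambda>q. \<omega> q (Y q) (Z q))
   - \<omega> p (lie_bracket A Y Z p) (W p)
   + \<omega> p (lie_bracket A Y W p) (Z p)
   - \<omega> p (lie_bracket A Z W p) (Y p)"

definition closed_two_form ::
  "'a topology \<Rightarrow> ('a, 'e::euclidean_space) chart set \<Rightarrow> ('a \<Rightarrow> ('a, 'e) bform) \<Rightarrow> bool" where
  "closed_two_form X A \<omega> \<longleftrightarrow> two_form X A \<omega> \<and>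
     (\<forall>Y Z W. smooth_vfield A Y \<and> smooth_vfield A Z \<and> smooth_vfield A W \<longrightarrow>
        (\<forall>p\<in>topspace X. ext_deriv A \<omega> Y Z W p = 0))"


section \<open>The Levi-Civita connection\<close>

type_synonym ('a, 'e) connection = "('a, 'e) vfield \<Rightarrow> ('a, 'e) vfield \<Rightarrow> ('a, 'e) vfield"

text \<open>Here \<open>nabla Y Z\<close> is the covariant derivative of \<open>Z\<close> in direction \<open>Y\<close>.\<close>

definition affine_connection ::
  "'a topology \<Rightarrow> ('a, 'e::euclidean_space) chart set \<Rightarrow> ('a, 'e) connection \<Rightarrow> bool" where
  "affine_connection X A nabla \<longleftrightarrow>
     (\<forall>Y Z. smooth_vfield A Y \<and> smooth_vfield A Z \<longrightarrow> smooth_vfield A (nabla Y Z)) \<and>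
     (\<forall>Y Y' Z f. smooth_vfield A Y \<and> smooth_vfield A Y' \<and> smooth_vfield A Z \<and> smooth_fun A f \<longrightarrow>
        (\<forall>p\<in>topspace X.
           nabla (\<lambda>q. f q *\<^sub>R Y q + Y' q) Z p = f p *\<^sub>R nabla Y Z p + nabla Y' Z p)) \<and>
     (\<forall>Y Z Z'. smooth_vfield A Y \<and> smooth_vfield A Z \<and> smooth_vfield A Z' \<longrightarrow>
        (\<forall>p\<in>topspace X. nabla Y (\<lambda>q. Z q + Z' q) p = nabla Y Z p + nabla Y Z' p)) \<and>
     (\<forall>Y Z f. smooth_vfield A Y \<and> smooth_vfield A Z \<and> smooth_fun A f \<longrightarrow>
        (\<forall>p\<in>topspace X.
           nabla Y (\<lambda>q. f q *\<^sub>R Z q) p = dir_deriv A p (Y p) f *\<^sub>R Z p + f p *\<^sub>R nabla Y Z p))"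

definition torsion_free ::
  "'a topology \<Rightarrow> ('a, 'e::euclidean_space) chart set \<Rightarrow> ('a, 'e) connection \<Rightarrow> bool" where
  "torsion_free X A nabla \<longleftrightarrow>
     (\<forall>Y Z. smooth_vfield A Y \<and> smooth_vfield A Z \<longrightarrow>
        (\<forall>p\<in>topspace X. nabla Y Z p - nabla Z Y p = lie_bracket A Y Z p))"

text \<open>The covariant derivative of \<open>\<beta>\<close> in direction \<open>Y\<close>, evaluated on \<open>Z\<close> and \<open>W\<close>.\<close>

definition cov_deriv ::
  "('a, 'e::euclidean_space) chart set \<Rightarrow> ('a, 'e) connection \<Rightarrow> ('a \<Rightarrow> ('a, 'e) bform) \<Rightarrow>
   ('a, 'e) vfield \<Rightarrow> ('a, 'e) vfield \<Rightarrow> ('a, 'e) vfield \<Rightarrow> 'a \<Rightarrow> real" where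
  "cov_deriv A nabla \<beta> Y Z W p =
     dir_deriv A p (Y p) (\<lambda>q. \<beta> q (Z q) (W q))
   - \<beta> p (nabla Y Z p) (W p) - \<beta> p (Z p) (nabla Y W p)"

definition parallel ::
  "'a topology \<Rightarrow> ('a, 'e::euclidean_space) chart set \<Rightarrow> ('a, 'e) connection \<Rightarrow>
   ('a \<Rightarrow> ('a, 'e) bform) \<Rightarrow> bool" where
  "parallel X A nabla \<beta> \<longleftrightarrow> smooth_bilinear_field X A \<beta> \<and>
     (\<forall>Y Z W. smooth_vfield A Y \<and> smooth_vfield A Z \<and> smooth_vfield A W \<longrightarrow>
        (\<forall>p\<in>topspace X. cov_deriv A nabla \<beta> Y Z W p = 0))"

definition levi_civita ::
  "'a topology \<Rightarrow> ('a, 'e::euclidean_space) chart set \<Rightarrow> ('a \<Rightarrow> ('a, 'e) bform) \<Rightarrow>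
   ('a, 'e) connection \<Rightarrow> bool" where
  "levi_civita X A g nabla \<longleftrightarrow>
     affine_connection X A nabla \<and> torsion_free X A nabla \<and> parallel X A nabla g"


section \<open>Polysymplectic and almost Kaehler manifolds\<close>

definition wedge :: "('v \<Rightarrow> real) \<Rightarrow> ('v \<Rightarrow> real) \<Rightarrow> 'v \<Rightarrow> 'v \<Rightarrow> real" where
  "wedge \<alpha> \<beta> u v = \<alpha> u * \<beta> v - \<alpha> v * \<beta> u"

text \<open>A basis consisting of vectors \<open>v i\<close> and \<open>w j i\<close>, for \<open>1 \<le> i \<le> n\<close> and \<open>1 \<le> j \<le> s\<close>, is
  encoded as the family \<open>b\<close> with \<open>b (0, i) = v i\<close> and \<open>b (j, i) = w j i\<close>.\<close>

definition poly_index :: "nat \<Rightarrow> nat \<Rightarrow> (nat \<times> nat) set" where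
  "poly_index n s = {0..s} \<times> {1..n}"

definition basis_of :: "'v::real_vector set \<Rightarrow> 'i set \<Rightarrow> ('i \<Rightarrow> 'v) \<Rightarrow> bool" where
  "basis_of T I b \<longleftrightarrow> inj_on b I \<and> independent (b ` I) \<and> span (b ` I) = T"

text \<open>The element \<open>(b k)\<^sup>*\<close> of the dual basis.\<close>

definition dual_vec :: "'i set \<Rightarrow> ('i \<Rightarrow> 'v::real_vector) \<Rightarrow> 'i \<Rightarrow> 'v \<Rightarrow> real" where
  "dual_vec I b k u = representation (b ` I) u (b k)"

definition standard_basis ::
  "'v::real_vector set \<Rightarrow> nat \<Rightarrow> nat \<Rightarrow> (nat \<Rightarrow> 'v \<Rightarrow> 'v \<Rightarrow> real) \<Rightarrow> (nat \<times> nat \<Rightarrow> 'v) \<Rightarrow> bool"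
  where
  "standard_basis T n s \<omega> b \<longleftrightarrow>
     basis_of T (poly_index n s) b \<and>
     (\<forall>j\<in>{1..s}. \<forall>u\<in>T. \<forall>v\<in>T. \<omega> j u v =
        (\<Sum>i = 1..n. wedge (dual_vec (poly_index n s) b (0, i))
                             (dual_vec (poly_index n s) b (j, i)) u v))"

definition orthonormal_family ::
  "('v \<Rightarrow> 'v \<Rightarrow> real) \<Rightarrow> 'i set \<Rightarrow> ('i \<Rightarrow> 'v) \<Rightarrow> bool" where
  "orthonormal_family g I b \<longleftrightarrow> (\<forall>k\<in>I. \<forall>l\<in>I. g (b k) (b l) = (if k = l then 1 else 0))"

definition polysymplectic_structure ::
  "'v::real_vector set \<Rightarrow> nat \<Rightarrow> nat \<Rightarrow> (nat \<Rightarrow> 'v \<Rightarrow> 'v \<Rightarrow> real) \<Rightarrow> bool" where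
  "polysymplectic_structure T n s \<omega> \<longleftrightarrow>
     (\<forall>j\<in>{1..s}. bilinear_on T (\<omega> j) \<and> alternating_on T (\<omega> j)) \<and>
     (\<exists>b. standard_basis T n s \<omega> b)"

definition perp :: "'v set \<Rightarrow> ('v \<Rightarrow> 'v \<Rightarrow> real) \<Rightarrow> 'v set" where
  "perp T \<alpha> = {v \<in> T. \<forall>u\<in>T. \<alpha> v u = 0}"

text \<open>A distribution is integrable if around every point there is a flat chart: the distribution
  consists of the vectors tangent to the slices parallel to a fixed linear subspace of the
  model space.\<close>

definition integrable_distribution ::
  "'a topology \<Rightarrow> ('a, 'e::euclidean_space) chart set \<Rightarrow> ('a \<Rightarrow> ('a, 'e) tvec set) \<Rightarrow> bool" where
  "integrable_distribution X A \<Delta> \<longleftrightarrow>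
     (\<forall>p\<in>topspace X. \<exists>c\<in>charts_at A p. \<exists>S. subspace S \<and>
        (\<forall>q\<in>fst c. \<Delta> q = {v \<in> tangent_space A q. v c \<in> S}))"

definition perp_sum ::
  "('a, 'e::euclidean_space) chart set \<Rightarrow> nat \<Rightarrow> (nat \<Rightarrow> 'a \<Rightarrow> ('a, 'e) bform) \<Rightarrow>
   'a \<Rightarrow> ('a, 'e) tvec set" where
  "perp_sum A s \<omega> p =
     {\<Sum>j = 1..s. v j | v. \<forall>j\<in>{1..s}. v j \<in> perp (tangent_space A p) (\<omega> j p)}"

definition polysymplectic_manifold ::
  "'a topology \<Rightarrow> ('a, 'e::euclidean_space) chart set \<Rightarrow> nat \<Rightarrow> nat \<Rightarrow>
   (nat \<Rightarrow> 'a \<Rightarrow> ('a, 'e) bform) \<Rightarrow> bool" where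
  "polysymplectic_manifold X A n s \<omega> \<longleftrightarrow>
     smooth_manifold X A \<and> DIM('e) = n * (s + 1) \<and>
     (\<forall>j\<in>{1..s}. closed_two_form X A (\<omega> j)) \<and>
     (\<forall>p\<in>topspace X. polysymplectic_structure (tangent_space A p) n s (\<lambda>j. \<omega> j p)) \<and>
     integrable_distribution X A (perp_sum A s \<omega>)"

definition orthonormal_standard_basis ::
  "('a, 'e::euclidean_space) chart set \<Rightarrow> nat \<Rightarrow> nat \<Rightarrow> (nat \<Rightarrow> 'a \<Rightarrow> ('a, 'e) bform) \<Rightarrow>
   ('a \<Rightarrow> ('a, 'e) bform) \<Rightarrow> 'a \<Rightarrow> (nat \<times> nat \<Rightarrow> ('a, 'e) tvec) \<Rightarrow> bool" where
  "orthonormal_standard_basis A n s \<omega> g p b \<longleftrightarrow>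
     standard_basis (tangent_space A p) n s (\<lambda>j. \<omega> j p) b \<and>
     orthonormal_family (g p) (poly_index n s) b"

definition almost_kahler ::
  "'a topology \<Rightarrow> ('a, 'e::euclidean_space) chart set \<Rightarrow> nat \<Rightarrow> nat \<Rightarrow>
   (nat \<Rightarrow> 'a \<Rightarrow> ('a, 'e) bform) \<Rightarrow> ('a \<Rightarrow> ('a, 'e) bform) \<Rightarrow> bool" where
  "almost_kahler X A n s \<omega> g \<longleftrightarrow>
     polysymplectic_manifold X A n s \<omega> \<and> riemannian_metric X A g \<and>
     (\<forall>p\<in>topspace X. \<exists>b. orthonormal_standard_basis A n s \<omega> g p b)"

text \<open>Dual basis vectors vanish outside of the tangent space, so the form
  below is determined as a total function.\<close>

definition dualizing_form ::
  "('a, 'e::euclidean_space) chart set \<Rightarrow> nat \<Rightarrow> (nat \<Rightarrow> 'a \<Rightarrow> ('a, 'e) bform) \<Rightarrow>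
   ('a \<Rightarrow> ('a, 'e) bform) \<Rightarrow> 'a \<Rightarrow> ('a, 'e) bform" where
  "dualizing_form A n \<omega> g p =
     (THE \<alpha>. \<exists>b. orthonormal_standard_basis A n 2 \<omega> g p b \<and>
        \<alpha> = (\<lambda>u v. \<Sum>i = 1..n. wedge (dual_vec (poly_index n 2) b (1, i))
                                      (dual_vec (poly_index n 2) b (2, i)) u v))"

definition weakly_self_dual ::
  "'a topology \<Rightarrow> ('a, 'e::euclidean_space) chart set \<Rightarrow> nat \<Rightarrow>
   (nat \<Rightarrow> 'a \<Rightarrow> ('a, 'e) bform) \<Rightarrow> ('a \<Rightarrow> ('a, 'e) bform) \<Rightarrow> bool" where
  "weakly_self_dual X A n \<omega> g \<longleftrightarrow> closed_two_form X A (dualizing_form A n \<omega> g)"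

end

theory Submission
  imports Defs
begin

text \<open>Let \<open>A\<^sub>j\<close> be the endomorphism field with \<open>g(A\<^sub>j u, v) = \<omega>\<^sub>j(u, v)\<close>. In an orthonormal standard
  basis one checks \<open>\<omega>\<^sub>D(u, v) = g(A\<^sub>1 u, A\<^sub>2 v) - g(A\<^sub>2 u, A\<^sub>1 v)\<close>. This formula contains no basis, so
  \<open>\<omega>\<^sub>D\<close> is well defined and smooth. As \<open>g\<close> and \<open>\<omega>\<^sub>j\<close> are parallel, \<open>\<nabla>\<close> commutes with \<open>A\<^sub>j\<close>, and
  differentiating the formula gives \<open>\<nabla>\<omega>\<^sub>D = 0\<close>. Since \<open>\<nabla>\<close> is torsion-free, a parallel \<open>2\<close>-form
  is closed.\<close>

section \<open>Calculus of smooth maps\<close>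

text \<open>The formula for \<omega>_D arises because \<omega>_D pairs coefficients in two mutually
  orthogonal blocks of the basis. Up to sign, \<open>A_1\<close> and \<open>A_2\<close> move the
  \<open>w^1\<close>- and \<open>w^2\<close>-coefficients into the common block of the
  \<open>v_i\<close>, where the metric can pair them. The proof is shaped by two obstacles.
  Orthonormal standard bases are given point by point, with no smooth choice, so neither smoothness
  nor derivatives can be read off from them. And \<nabla> is an operator on globally defined smooth
  fields, so it cannot be applied to local frames. Therefore the \<open>A_j\<close> are never formed
  as tensors: a global field \<open>Z\<close> is accompanied by global fields \<open>Z_j\<close>
  with g(Z_j, W) = \<omega>_j(Z, W) for all \<open>W\<close>. Their smoothness is a statement about
  linear systems with smooth positive definite coefficients in a chart. Their pointwise uniqueness
  makes the local solutions fit together without a partition of unity.\<close>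

lemma frechet_derivative_cong_open:
  assumes "open S" "x \<in> S" "\<And>y. y \<in> S \<Longrightarrow> f y = h y"
  shows "frechet_derivative f (at x) = frechet_derivative h (at x)"
proof -
  \<comment> \<open>Differentiability is not assumed: \<open>frechet_derivative\<close> is chosen
    from the set of derivatives, and that set, empty or not, is the same for both maps.\<close>
  have "(f has_derivative D) (at x) \<longleftrightarrow> (h has_derivative D) (at x)" for D
    by (rule iffI; erule has_derivative_transform_within_open[OF _ assms(1,2)]) (simp_all add: assms(3))
  then show ?thesis
    by (simp only: frechet_derivative_def)
qed

text \<open>Coordinate expressions contain \<open>inv_into\<close>, which carries no information off
  the chart image, so they can be rewritten only on that open set. The induction varies both maps,
  since its next stage concerns their derivatives.\<close>

lemma Ck_on_cong:
  assumes "open S" "\<And>x. x \<in> S \<Longrightarrow> f x = h x" "Ck_on k S f"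
  shows "Ck_on k S h"
  using assms(2,3)
proof (induction k arbitrary: f h)
  case 0
  have "continuous_on S f = continuous_on S h"
    by (rule continuous_on_cong) (rule refl, erule 0(1))
  with 0(2) show ?case unfolding Ck_on.simps by blast
next
  case (Suc k)
  have "h differentiable (at x)" if x: "x \<in> S" for x
  proof -
    have "(f has_derivative frechet_derivative f (at x)) (at x)"
      using Suc.prems(2) x unfolding Ck_on.simps frechet_derivative_works by blast
    then have "(h has_derivative frechet_derivative f (at x)) (at x)"
      by (rule has_derivative_transform_within_open[OF _ assms(1) x]) (erule Suc.prems(1))
    then show ?thesis by (rule differentiableI)
  qed
  moreover have "Ck_on k S (\<lambda>x. frechet_derivative h (at x) v)" for v
  proof (rule Suc.IH)
    show "Ck_on k S (\<lambda>x. frechet_derivative f (at x) v)"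
      using Suc.prems(2) unfolding Ck_on.simps by blast
    show "frechet_derivative f (at x) v = frechet_derivative h (at x) v" if x: "x \<in> S" for x
    proof -
      have "frechet_derivative f (at x) = frechet_derivative h (at x)"
        by (rule frechet_derivative_cong_open[OF assms(1) x]) (erule Suc.prems(1))
      then show ?thesis by (rule fun_cong)
    qed
  qed
  ultimately show ?case unfolding Ck_on.simps by blast
qed

text \<open>Replaces the chosen \<open>frechet_derivative\<close> by an explicit derivative
  \<open>D\<close>, so that the rules of calculus can drive the inductions below.\<close>

lemma Ck_on_SucI:
  assumes "open S" and D: "\<And>x. x \<in> S \<Longrightarrow> (f has_derivative D x) (at x)"
    and Ck: "\<And>v. Ck_on k S (\<lambda>x. D x v)"
  shows "Ck_on (Suc k) S f"
proof -
  have "D x v = frechet_derivative f (at x) v" if "x \<in> S" for x v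
    using frechet_derivative_at[OF D[OF that]] by (rule fun_cong)
  then have "Ck_on k S (\<lambda>x. frechet_derivative f (at x) v)" for v
    by (rule Ck_on_cong[OF assms(1) _ Ck])
  moreover have "f differentiable (at x)" if "x \<in> S" for x
    using D[OF that] by (rule differentiableI)
  ultimately show ?thesis
    unfolding Ck_on.simps by blast
qed

lemma Ck_on_SucD:
  assumes "Ck_on (Suc k) S f" "x \<in> S"
  shows "(f has_derivative frechet_derivative f (at x)) (at x)"
  using assms unfolding Ck_on.simps frechet_derivative_works by blast

lemma Ck_on_Suc_imp: "Ck_on (Suc k) S f \<Longrightarrow> Ck_on k S f"
proof (induction k arbitrary: f)
  case 0
  then show ?case
    by (simp add: differentiable_imp_continuous_on differentiable_at_imp_differentiable_on)
next
  case (Suc k)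
  have "Ck_on k S (\<lambda>x. frechet_derivative f (at x) v)" for v
    using Suc.prems by (intro Suc.IH) simp
  then show ?case using Suc.prems by simp
qed

lemma Ck_on_const: "open S \<Longrightarrow> Ck_on k S (\<lambda>x. a)"
proof (induction k arbitrary: a)
  case (Suc k)
  show ?case
    by (rule Ck_on_SucI[where D = "\<lambda>x v. 0"]) (use Suc in auto)
qed auto

lemma Ck_on_add: "open S \<Longrightarrow> Ck_on k S f \<Longrightarrow> Ck_on k S h \<Longrightarrow> Ck_on k S (\<lambda>x. f x + h x)"
proof (induction k arbitrary: f h)
  case 0
  then show ?case by (auto intro: continuous_intros)
next
  case (Suc k)
  show ?case
  proof (rule Ck_on_SucI)
    show "((\<lambda>x. f x + h x) has_derivative
      (\<lambda>v. frechet_derivative f (at x) v + frechet_derivative h (at x) v)) (at x)" if "x \<in> S" for x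
      using Suc.prems that by (intro has_derivative_add Ck_on_SucD)
  qed (use Suc in auto)
qed

text \<open>The product rule pairs a derivative of class \<open>k\<close> with an undifferentiated
  factor of class \<open>Suc k\<close>, which \<open>Ck_on_Suc_imp\<close> lowers to
  \<open>k\<close>. One lemma covers real products, scalar multiples and inner products.\<close>

lemma Ck_on_bilinear:
  assumes "bounded_bilinear pr" "open S"
  shows "Ck_on k S f \<Longrightarrow> Ck_on k S h \<Longrightarrow> Ck_on k S (\<lambda>x. pr (f x) (h x))"
proof (induction k arbitrary: f h)
  case 0
  then show ?case using bounded_bilinear.continuous_on[OF assms(1)] by auto
next
  case (Suc k)
  show ?case
  proof (rule Ck_on_SucI)
    show "((\<lambda>x. pr (f x) (h x)) has_derivative
      (\<lambda>v. pr (f x) (frechet_derivative h (at x) v) + pr (frechet_derivative f (at x) v) (h x))) (at x)"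
      if "x \<in> S" for x
      using Suc.prems that by (intro bounded_bilinear.FDERIV[OF assms(1)] Ck_on_SucD)
    show "Ck_on k S
      (\<lambda>x. pr (f x) (frechet_derivative h (at x) v) + pr (frechet_derivative f (at x) v) (h x))" for v
      using Suc.prems Ck_on_Suc_imp[OF Suc.prems(1)] Ck_on_Suc_imp[OF Suc.prems(2)]
      by (intro Ck_on_add Suc.IH assms(2)) simp_all
  qed (fact assms)
qed

lemma Ck_on_inverse:
  fixes f :: "'e::real_normed_vector \<Rightarrow> real"
  assumes "open S" "\<And>x. x \<in> S \<Longrightarrow> f x \<noteq> 0"
  shows "Ck_on k S f \<Longrightarrow> Ck_on k S (\<lambda>x. inverse (f x))"
proof (induction k)
  case 0
  then show ?case using assms by (auto intro: continuous_intros)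
next
  case (Suc k)
  have inv: "Ck_on k S (\<lambda>x. inverse (f x))"
    using Suc Ck_on_Suc_imp by blast
  note mult = Ck_on_bilinear[OF bounded_bilinear_mult assms(1)]
  show ?case
  proof (rule Ck_on_SucI)
    \<comment> \<open>The derivative is again a product involving \<open>inverse (f x)\<close>, for
      which the induction hypothesis is available. The sign is written as a factor
      \<open>- 1\<close>, so that the product rule covers it too.\<close>
    show "((\<lambda>x. inverse (f x)) has_derivative
      (\<lambda>v. - 1 * (inverse (f x) * frechet_derivative f (at x) v * inverse (f x)))) (at x)" if "x \<in> S" for x
      using Deriv.has_derivative_inverse[OF assms(2)[OF that] Ck_on_SucD[OF Suc.prems that]] by simp
    show "Ck_on k S (\<lambda>x. - 1 * (inverse (f x) * frechet_derivative f (at x) v * inverse (f x)))" for v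
      using Suc.prems inv by (intro mult Ck_on_const assms(1)) auto
  qed (fact assms)
qed

section \<open>Closure properties of smooth maps\<close>

lemma smooth_on_cong: "open S \<Longrightarrow> smooth_on S f \<Longrightarrow> (\<And>x. x \<in> S \<Longrightarrow> f x = h x) \<Longrightarrow> smooth_on S h"
  using Ck_on_cong unfolding smooth_on_def by blast

lemma smooth_on_const: "open S \<Longrightarrow> smooth_on S (\<lambda>x. a)"
  using Ck_on_const unfolding smooth_on_def by blast

lemma smooth_on_add: "open S \<Longrightarrow> smooth_on S f \<Longrightarrow> smooth_on S h \<Longrightarrow> smooth_on S (\<lambda>x. f x + h x)"
  using Ck_on_add unfolding smooth_on_def by blast

lemma smooth_on_bilinear:
  "bounded_bilinear pr \<Longrightarrow> open S \<Longrightarrow> smooth_on S f \<Longrightarrow> smooth_on S h \<Longrightarrow>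
    smooth_on S (\<lambda>x. pr (f x) (h x))"
  using Ck_on_bilinear unfolding smooth_on_def by blast

lemmas smooth_on_mult = smooth_on_bilinear[OF bounded_bilinear_mult]
lemmas smooth_on_scaleR = smooth_on_bilinear[OF bounded_bilinear_scaleR]
lemmas smooth_on_inner = smooth_on_bilinear[OF bounded_bilinear_inner]

lemma smooth_on_diff:
  assumes "open S" "smooth_on S f" "smooth_on S h"
  shows "smooth_on S (\<lambda>x. f x - h x)"
  using smooth_on_add[OF assms(1,2) smooth_on_scaleR[OF assms(1) smooth_on_const[OF assms(1)] assms(3)],
      of "-1"] by simp

lemma smooth_on_divide:
  fixes f h :: "'e::real_normed_vector \<Rightarrow> real"
  assumes "open S" "smooth_on S f" "smooth_on S h" "\<And>x. x \<in> S \<Longrightarrow> h x \<noteq> 0"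
  shows "smooth_on S (\<lambda>x. f x / h x)"
  unfolding divide_inverse using assms(3) Ck_on_inverse[OF assms(1,4)]
  by (intro smooth_on_mult assms(1,2)) (simp add: smooth_on_def)

lemma smooth_on_sum:
  assumes "open S" "finite I" "\<And>i. i \<in> I \<Longrightarrow> smooth_on S (f i)"
  shows "smooth_on S (\<lambda>x. \<Sum>i\<in>I. f i x)"
  using assms(2,3)
  by (induction I) (auto intro: smooth_on_const smooth_on_add assms(1))

lemma smooth_on_imp_differentiable:
  assumes "smooth_on S f" "x \<in> S"
  shows "f differentiable (at x)"
  using assms(1)[unfolded smooth_on_def, rule_format, of "Suc 0"] assms(2) by simp

section \<open>Bilinear forms and linear systems with smooth coefficients\<close>

lemma smooth_on_bilinear_coefficients:
  fixes G :: "'e::euclidean_space \<Rightarrow> 'e \<Rightarrow> 'e \<Rightarrow> real"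
  assumes "open S" "\<And>x. x \<in> S \<Longrightarrow> bilinear (G x)" "\<And>a b. smooth_on S (\<lambda>x. G x a b)"
    and "smooth_on S F" "smooth_on S H"
  shows "smooth_on S (\<lambda>x. G x (F x) (H x))"
proof (rule smooth_on_cong[OF assms(1)])
  \<comment> \<open>Smoothness of \<open>G\<close> is known for constant arguments only, so the
    varying arguments are expanded in the standard basis, whose elements are constant.\<close>
  show "smooth_on S (\<lambda>x. \<Sum>i\<in>Basis. \<Sum>j\<in>Basis. (F x \<bullet> i) * ((H x \<bullet> j) * G x i j))"
    by (intro smooth_on_sum smooth_on_mult smooth_on_inner smooth_on_const assms) auto
  show "(\<Sum>i\<in>Basis. \<Sum>j\<in>Basis. (F x \<bullet> i) * ((H x \<bullet> j) * G x i j)) = G x (F x) (H x)" if "x \<in> S" for x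
  proof -
    interpret b: bounded_bilinear "G x"
      using assms(2)[OF that] by (simp add: bilinear_conv_bounded_bilinear)
    have "G x (F x) (H x) = G x (\<Sum>i\<in>Basis. (F x \<bullet> i) *\<^sub>R i) (\<Sum>j\<in>Basis. (H x \<bullet> j) *\<^sub>R j)"
      by (simp add: euclidean_representation)
    also have "\<dots> = (\<Sum>j\<in>Basis. \<Sum>i\<in>Basis. (F x \<bullet> i) * ((H x \<bullet> j) * G x i j))"
      by (simp add: b.sum_left b.sum_right b.scaleR_left b.scaleR_right sum_distrib_left mult.left_commute)
    also have "\<dots> = (\<Sum>i\<in>Basis. \<Sum>j\<in>Basis. (F x \<bullet> i) * ((H x \<bullet> j) * G x i j))"
      by (rule sum.swap)
    finally show ?thesis by (rule sym)
  qed
qed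

text \<open>Gram-Schmidt in disguise: solving the subsystem for \<open>B\<close> with right-hand side \<open>G x a b\<close>
  yields the \<open>G\<close>-orthogonal projection of the next vector \<open>a\<close> to the span of \<open>B\<close>, and a multiple
  of the orthogonal remainder adjusts the one new equation.\<close>

lemma smooth_solution_on_span:
  fixes G :: "'e::euclidean_space \<Rightarrow> 'e \<Rightarrow> 'e \<Rightarrow> real"
  assumes S: "open S" and bil: "\<And>x. x \<in> S \<Longrightarrow> bilinear (G x)"
    and sm: "\<And>a b. smooth_on S (\<lambda>x. G x a b)"
    and pos: "\<And>x a. x \<in> S \<Longrightarrow> a \<noteq> 0 \<Longrightarrow> G x a a > 0"
    and B: "finite B" "independent B"
    and h: "\<And>b. b \<in> B \<Longrightarrow> smooth_on S (h b)"
  shows "\<exists>F. smooth_on S F \<and> (\<forall>x\<in>S. F x \<in> span B \<and> (\<forall>b\<in>B. G x (F x) b = h b x))"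
  using B h
proof (induction B arbitrary: h)
  case empty
  have "smooth_on S (\<lambda>x. 0)" by (rule smooth_on_const[OF S])
  then show ?case by (intro exI[of _ "\<lambda>x. 0"]) auto
next
  case (insert a B)
  have ind: "independent B" "a \<notin> span B"
    using insert.prems(1) insert.hyps(2) by (auto simp: independent_insert)
  obtain P where P: "smooth_on S P" "\<And>x. x \<in> S \<Longrightarrow> P x \<in> span B"
    "\<And>x b. x \<in> S \<Longrightarrow> b \<in> B \<Longrightarrow> G x (P x) b = G x a b"
    using insert.IH[OF ind(1), of "\<lambda>b x. G x a b"] sm by blast
  obtain F where F: "smooth_on S F" "\<And>x. x \<in> S \<Longrightarrow> F x \<in> span B"
    "\<And>x b. x \<in> S \<Longrightarrow> b \<in> B \<Longrightarrow> G x (F x) b = h b x"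
    using insert.IH[OF ind(1), of h] insert.prems(2) by blast
  define R where "R x = a - P x" for x
  define t where "t x = (h a x - G x (F x) a) / G x (R x) a" for x
  have R_orth: "G x (R x) b = 0" if "x \<in> S" "b \<in> span B" for x b
    using that(2)
  proof (rule span_induct)
    show "subspace {b. G x (R x) b = 0}"
      using bil[OF that(1)] by (auto simp: bilinear_def intro: linear_subspace_kernel)
    show "G x (R x) b = 0" if "b \<in> B" for b
      using P(3) bil \<open>x \<in> S\<close> that by (simp add: R_def bilinear_lsub)
  qed
  \<comment> \<open>As \<open>a = R x + P x\<close> with \<open>P x\<close> in the span of
    \<open>B\<close>, this number equals \<open>G x (R x) (R x)\<close>, and \<open>R x\<close> is
    nonzero because \<open>a\<close> lies outside that span. Hence the division in \<open>t\<close>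
    is smooth.\<close>
  have R_pos: "G x (R x) a > 0" if "x \<in> S" for x
  proof -
    have "R x \<noteq> 0" using P(2)[OF that] ind(2) by (auto simp: R_def)
    then have "G x (R x) (R x) > 0" using pos that by blast
    moreover have "G x (R x) a = G x (R x) (R x) + G x (R x) (P x)"
      using bil[OF that] by (simp add: R_def flip: bilinear_radd)
    ultimately show ?thesis using R_orth P(2) that by simp
  qed
  have R_smooth: "smooth_on S R"
    unfolding R_def by (intro smooth_on_diff smooth_on_const S P)
  have G_smooth: "smooth_on S (\<lambda>x. G x (H x) a)" if "smooth_on S H" for H
    using smooth_on_bilinear_coefficients[OF S bil sm that smooth_on_const[OF S]] .
  have "smooth_on S t"
    unfolding t_def using insert.prems(2) R_pos
    by (intro smooth_on_divide smooth_on_diff G_smooth S F R_smooth) force+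
  then have "smooth_on S (\<lambda>x. F x + t x *\<^sub>R R x)"
    by (intro smooth_on_add smooth_on_scaleR S F R_smooth)
  moreover have "F x + t x *\<^sub>R R x \<in> span (insert a B)" if "x \<in> S" for x
  proof -
    have "F x \<in> span (insert a B)" "P x \<in> span (insert a B)"
      using F(2) P(2) that span_mono[of B "insert a B"] by auto
    then show ?thesis
      unfolding R_def by (intro span_add span_scale span_diff) (auto intro: span_base)
  qed
  moreover have "G x (F x + t x *\<^sub>R R x) b = h b x" if "x \<in> S" "b \<in> insert a B" for x b
    using that R_pos[OF that(1)] R_orth[OF that(1)] F(3)[OF that(1)] bil[OF that(1)]
    by (auto simp: bilinear_ladd bilinear_lmul t_def span_base)
  ultimately show ?case by (intro exI[of _ "\<lambda>x. F x + t x *\<^sub>R R x"]) blast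
qed

text \<open>The standard basis turns the condition on \<open>b\<close> into a finite linear system,
  and linearity of both sides recovers all \<open>b\<close>. Smooth dependence on \<open>x\<close>
  is obtained without inverting the Gram matrix.\<close>

lemma smooth_Riesz_representative:
  fixes G :: "'e::euclidean_space \<Rightarrow> 'e \<Rightarrow> 'e \<Rightarrow> real"
  assumes "open S" "\<And>x. x \<in> S \<Longrightarrow> bilinear (G x)" "\<And>a b. smooth_on S (\<lambda>x. G x a b)"
    and "\<And>x a. x \<in> S \<Longrightarrow> a \<noteq> 0 \<Longrightarrow> G x a a > 0"
    and "\<And>x. x \<in> S \<Longrightarrow> linear (h x)" "\<And>b. smooth_on S (\<lambda>x. h x b)"
  shows "\<exists>F. smooth_on S F \<and> (\<forall>x\<in>S. \<forall>b. G x (F x) b = h x b)"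
proof -
  obtain F where F: "smooth_on S F" "\<And>x b. x \<in> S \<Longrightarrow> b \<in> Basis \<Longrightarrow> G x (F x) b = h x b"
    using smooth_solution_on_span[OF assms(1-4) finite_Basis independent_Basis, of "\<lambda>b x. h x b"] assms(6)
    by blast
  have "G x (F x) b = h x b" if "x \<in> S" for x b
    using linear_eq_stdbasis[of "G x (F x)" "h x"] F(2) assms(2,5) that by (auto simp: bilinear_def)
  then show ?thesis using F(1) by blast
qed

section \<open>Tangent spaces\<close>

lemma
  assumes "smooth_manifold X A" "c \<in> A"
  shows chart_openin: "openin X (fst c)"
    and open_chart_im: "open (chart_im c)"
    and inj_on_chart: "inj_on (snd c) (fst c)"
    and chart_subset_topspace: "fst c \<subseteq> topspace X"
proof -
  have c: "is_chart X c" using assms by (auto simp: smooth_manifold_def)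
  then show "openin X (fst c)" "open (chart_im c)" by (auto simp: is_chart_def)
  then show sub: "fst c \<subseteq> topspace X" by (simp add: openin_subset)
  then show "inj_on (snd c) (fst c)"
    using c by (auto simp: is_chart_def homeomorphic_map_def topspace_subtopology inf_absorb2)
qed

text \<open>Transition maps are meaningful on this set only, and their derivatives ignore outside
  values because it is open. A chart is an open map onto its image, and that image is open in the
  model space.\<close>

lemma open_chart_image_Int:
  assumes "smooth_manifold X A" "c \<in> A" "d \<in> A"
  shows "open (snd c ` (fst c \<inter> fst d))"
proof -
  have "open_map (subtopology X (fst c)) (top_of_set (chart_im c)) (snd c)"
    using assms by (auto simp: smooth_manifold_def is_chart_def intro: homeomorphic_imp_open_map)
  moreover have "openin (subtopology X (fst c)) (fst c \<inter> fst d)"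
    using chart_openin[OF assms(1,3)] by (auto simp: openin_subtopology)
  ultimately have "openin (top_of_set (chart_im c)) (snd c ` (fst c \<inter> fst d))"
    by (auto simp: open_map_def)
  then show ?thesis
    using openin_open_trans open_chart_im[OF assms(1,2)] by blast
qed

lemma transition_differentiable:
  assumes "smooth_manifold X A" "c \<in> charts_at A p" "d \<in> charts_at A p"
  shows "(snd d \<circ> chart_inv c) differentiable (at (snd c p))"
proof (rule smooth_on_imp_differentiable)
  show "smooth_on (snd c ` (fst c \<inter> fst d)) (snd d \<circ> chart_inv c)"
    using assms by (auto simp: smooth_manifold_def smoothly_compatible_def charts_at_def)
qed (use assms in \<open>auto simp: charts_at_def\<close>)

lemma transition_linear:
  assumes "smooth_manifold X A" "c \<in> charts_at A p" "d \<in> charts_at A p"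
  shows "linear (frechet_derivative (snd d \<circ> chart_inv c) (at (snd c p)))"
  by (rule linear_frechet_derivative[OF transition_differentiable[OF assms]])

lemma transition_refl:
  assumes "smooth_manifold X A" "c \<in> charts_at A p"
  shows "frechet_derivative (snd c \<circ> chart_inv c) (at (snd c p)) a = a"
proof -
  have "frechet_derivative (snd c \<circ> chart_inv c) (at (snd c p)) = frechet_derivative id (at (snd c p))"
    using assms by (intro frechet_derivative_cong_open[OF open_chart_im])
      (auto simp: charts_at_def f_inv_into_f)
  then show ?thesis by (simp add: frechet_derivative_id)
qed

text \<open>The chain rule. The composite of two transition maps is compared with the direct one on
  the image of the common domain of \<open>c\<close> and \<open>d\<close>, an open neighbourhood of
  the point.\<close>

lemma transition_trans:
  assumes "smooth_manifold X A" "c \<in> charts_at A p" "d \<in> charts_at A p" "e \<in> charts_at A p"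
  shows "frechet_derivative (snd e \<circ> chart_inv d) (at (snd d p))
      (frechet_derivative (snd d \<circ> chart_inv c) (at (snd c p)) a)
    = frechet_derivative (snd e \<circ> chart_inv c) (at (snd c p)) a"
proof -
  have inj: "inj_on (snd c) (fst c)" "inj_on (snd d) (fst d)"
    using assms inj_on_chart[OF assms(1)] by (simp_all add: charts_at_def)
  have p: "(snd d \<circ> chart_inv c) (snd c p) = snd d p"
    using assms inj by (auto simp: charts_at_def)
  have der: "(snd d \<circ> chart_inv c has_derivative frechet_derivative (snd d \<circ> chart_inv c) (at (snd c p)))
      (at (snd c p))"
    using transition_differentiable[OF assms(1-3)] by (simp only: frechet_derivative_works)
  have "(snd e \<circ> chart_inv d has_derivative frechet_derivative (snd e \<circ> chart_inv d) (at (snd d p)))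
      (at ((snd d \<circ> chart_inv c) (snd c p)))"
    using transition_differentiable[OF assms(1,3,4)] by (simp only: frechet_derivative_works p)
  from frechet_derivative_at[OF diff_chain_at[OF der this]]
  have "frechet_derivative ((snd e \<circ> chart_inv d) \<circ> (snd d \<circ> chart_inv c)) (at (snd c p)) a
    = frechet_derivative (snd e \<circ> chart_inv d) (at (snd d p))
        (frechet_derivative (snd d \<circ> chart_inv c) (at (snd c p)) a)"
    by (metis comp_apply)
  moreover have "frechet_derivative ((snd e \<circ> chart_inv d) \<circ> (snd d \<circ> chart_inv c)) (at (snd c p))
      = frechet_derivative (snd e \<circ> chart_inv c) (at (snd c p))"
    using assms inj by (intro frechet_derivative_cong_open[OF open_chart_image_Int[of X A c d]])
      (auto simp: charts_at_def)
  ultimately show ?thesis by simp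
qed

lemma tangent_spaceI:
  assumes "\<And>c. c \<notin> charts_at A p \<Longrightarrow> v c = 0"
    and "\<And>c d. c \<in> charts_at A p \<Longrightarrow> d \<in> charts_at A p \<Longrightarrow>
      v d = frechet_derivative (snd d \<circ> chart_inv c) (at (snd c p)) (v c)"
  shows "v \<in> tangent_space A p"
  unfolding tangent_space_def mem_Collect_eq using assms by blast

lemma tangent_space_transition:
  assumes "v \<in> tangent_space A p" "c \<in> charts_at A p" "d \<in> charts_at A p"
  shows "v d = frechet_derivative (snd d \<circ> chart_inv c) (at (snd c p)) (v c)"
  using assms unfolding tangent_space_def mem_Collect_eq by blast

lemma tangent_space_outside: "v \<in> tangent_space A p \<Longrightarrow> c \<notin> charts_at A p \<Longrightarrow> v c = 0"
  unfolding tangent_space_def mem_Collect_eq by blast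

lemma tangent_space_subspace:
  assumes "smooth_manifold X A"
  shows "subspace (tangent_space A p)"
proof (rule subspaceI)
  note lin = transition_linear[OF assms]
  show "0 \<in> tangent_space A p"
  proof (rule tangent_spaceI)
    show "0 d = frechet_derivative (snd d \<circ> chart_inv c) (at (snd c p)) (0 c)"
      if "c \<in> charts_at A p" "d \<in> charts_at A p" for c d
      using linear_0[OF lin[OF that]] by simp
  qed simp
  show "u + v \<in> tangent_space A p" if uv: "u \<in> tangent_space A p" "v \<in> tangent_space A p" for u v
  proof (rule tangent_spaceI)
    show "(u + v) d = frechet_derivative (snd d \<circ> chart_inv c) (at (snd c p)) ((u + v) c)"
      if cd: "c \<in> charts_at A p" "d \<in> charts_at A p" for c d
      unfolding plus_fun_apply linear_add[OF lin[OF cd]]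
      by (simp only: uv[THEN tangent_space_transition, OF cd])
    show "(u + v) c = 0" if "c \<notin> charts_at A p" for c
      unfolding plus_fun_apply uv[THEN tangent_space_outside, OF that] by simp
  qed
  show "r *\<^sub>R u \<in> tangent_space A p" if u: "u \<in> tangent_space A p" for r u
  proof (rule tangent_spaceI)
    show "(r *\<^sub>R u) d = frechet_derivative (snd d \<circ> chart_inv c) (at (snd c p)) ((r *\<^sub>R u) c)"
      if cd: "c \<in> charts_at A p" "d \<in> charts_at A p" for c d
      unfolding scaleR_fun_def linear_cmul[OF lin[OF cd]]
      by (simp only: tangent_space_transition[OF u cd])
    show "(r *\<^sub>R u) c = 0" if "c \<notin> charts_at A p" for c
      unfolding scaleR_fun_def tangent_space_outside[OF u that] by simp
  qed
qed

section \<open>Identification of a tangent space with the model space\<close>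

lemma coord_tvec_at:
  "d \<in> charts_at A p \<Longrightarrow>
    coord_tvec A c p a d = frechet_derivative (snd d \<circ> chart_inv c) (at (snd c p)) a"
  by (simp add: coord_tvec_def)

lemma coord_tvec_outside: "d \<notin> charts_at A p \<Longrightarrow> coord_tvec A c p a d = 0"
  by (simp add: coord_tvec_def)

lemma coord_tvec_in_tangent_space:
  assumes "smooth_manifold X A" "c \<in> charts_at A p"
  shows "coord_tvec A c p a \<in> tangent_space A p"
proof (rule tangent_spaceI)
  show "coord_tvec A c p a e = frechet_derivative (snd e \<circ> chart_inv d) (at (snd d p)) (coord_tvec A c p a d)"
    if "d \<in> charts_at A p" "e \<in> charts_at A p" for d e
    unfolding coord_tvec_at[OF that(1)] coord_tvec_at[OF that(2)] transition_trans[OF assms that] ..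
qed (rule coord_tvec_outside)

lemma coord_tvec_same_chart:
  assumes "smooth_manifold X A" "c \<in> charts_at A p"
  shows "coord_tvec A c p a c = a"
  unfolding coord_tvec_at[OF assms(2)] by (rule transition_refl[OF assms])

text \<open>Together with \<open>coord_tvec_same_chart\<close> this makes \<open>coord_tvec\<close>
  and evaluation at \<open>c\<close> mutually inverse, which carries problems to the model space and
  back. At charts not around \<open>p\<close> both sides have the default value zero.\<close>

lemma coord_tvec_of_coordinates:
  assumes "c \<in> charts_at A p" "v \<in> tangent_space A p"
  shows "coord_tvec A c p (v c) = v"
proof
  fix d
  show "coord_tvec A c p (v c) d = v d"
  proof (cases "d \<in> charts_at A p")
    case True
    show ?thesis unfolding coord_tvec_at[OF True] tangent_space_transition[OF assms(2,1) True] ..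
  next
    case False
    show ?thesis unfolding coord_tvec_outside[OF False] tangent_space_outside[OF assms(2) False] ..
  qed
qed

lemma linear_coord_tvec:
  assumes "smooth_manifold X A" "c \<in> charts_at A p"
  shows "linear (coord_tvec A c p)"
proof (rule linearI)
  note lin = transition_linear[OF assms]
  show "coord_tvec A c p (a + b) = coord_tvec A c p a + coord_tvec A c p b" for a b
  proof
    show "coord_tvec A c p (a + b) d = (coord_tvec A c p a + coord_tvec A c p b) d" for d
      by (cases "d \<in> charts_at A p") (simp_all add: coord_tvec_at coord_tvec_outside linear_add[OF lin])
  qed
  show "coord_tvec A c p (r *\<^sub>R a) = r *\<^sub>R coord_tvec A c p a" for r a
  proof
    show "coord_tvec A c p (r *\<^sub>R a) d = (r *\<^sub>R coord_tvec A c p a) d" for d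
      by (cases "d \<in> charts_at A p")
        (simp_all add: scaleR_fun_def coord_tvec_at coord_tvec_outside linear_cmul[OF lin])
  qed
qed

section \<open>Bilinear forms on subspaces\<close>

text \<open>Tangent spaces are subsets of a type of functions, so forms are bilinear relative to
  \<open>T\<close> and every rule carries membership premises.\<close>

lemma bilinear_on_combine:
  assumes "bilinear_on T \<beta>" "u \<in> T" "v \<in> T" "w \<in> T"
  shows "\<beta> (r *\<^sub>R u + v) w = r * \<beta> u w + \<beta> v w"
    and "\<beta> w (r *\<^sub>R u + v) = r * \<beta> w u + \<beta> w v"
  using assms unfolding bilinear_on_def by blast+

lemma bilinear_on_zero:
  assumes "bilinear_on T \<beta>" "subspace T" "w \<in> T"
  shows "\<beta> 0 w = 0" "\<beta> w 0 = 0"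
  \<comment> \<open>For \<open>r = 1\<close> and both vectors zero the law reads
    \<open>x = x + x\<close>.\<close>
  using bilinear_on_combine[OF assms(1) subspace_0[OF assms(2)] subspace_0[OF assms(2)] assms(3), of 1]
  by simp_all

lemma bilinear_on_add:
  assumes "bilinear_on T \<beta>" "u \<in> T" "v \<in> T" "w \<in> T"
  shows "\<beta> (u + v) w = \<beta> u w + \<beta> v w" "\<beta> w (u + v) = \<beta> w u + \<beta> w v"
  using bilinear_on_combine[OF assms, of 1] by simp_all

lemma bilinear_on_scaleR:
  assumes "bilinear_on T \<beta>" "subspace T" "u \<in> T" "w \<in> T"
  shows "\<beta> (r *\<^sub>R u) w = r * \<beta> u w" "\<beta> w (r *\<^sub>R u) = r * \<beta> w u"
  using bilinear_on_combine[OF assms(1,3) subspace_0[OF assms(2)] assms(4), of r]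
    bilinear_on_zero[OF assms(1,2,4)] by simp_all

lemma bilinear_on_diff:
  assumes "bilinear_on T \<beta>" "u \<in> T" "v \<in> T" "w \<in> T"
  shows "\<beta> (u - v) w = \<beta> u w - \<beta> v w" "\<beta> w (u - v) = \<beta> w u - \<beta> w v"
  using bilinear_on_combine[OF assms(1,3,2,4), of "-1"] by simp_all

lemma bilinear_on_sum_left:
  assumes "bilinear_on T \<beta>" "subspace T" "finite I" "\<And>k. k \<in> I \<Longrightarrow> b k \<in> T" "w \<in> T"
  shows "\<beta> (\<Sum>k\<in>I. r k *\<^sub>R b k) w = (\<Sum>k\<in>I. r k * \<beta> (b k) w)"
  using assms(3,4)
proof (induction I)
  case empty
  show ?case using bilinear_on_zero[OF assms(1,2,5)] by simp
next
  case (insert k I)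
  have "(\<Sum>k\<in>I. r k *\<^sub>R b k) \<in> T"
    using insert.prems by (intro subspace_sum subspace_scale assms(2)) simp
  then show ?case
    using insert bilinear_on_combine(1)[OF assms(1) _ _ assms(5)] by simp
qed

lemma alternating_on_swap:
  assumes "bilinear_on T \<beta>" "subspace T" "alternating_on T \<beta>" "u \<in> T" "v \<in> T"
  shows "\<beta> u v = - \<beta> v u"
proof -
  have "\<beta> (u + v) (u + v) = 0" "\<beta> u u = 0" "\<beta> v v = 0"
    using assms subspace_add by (auto simp: alternating_on_def)
  moreover have "\<beta> (u + v) (u + v) = \<beta> u u + \<beta> v u + (\<beta> u v + \<beta> v v)"
    using assms subspace_add[OF assms(2,4,5)] by (simp add: bilinear_on_add[OF assms(1)])
  ultimately show ?thesis by simp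
qed

section \<open>Orthonormal standard bases\<close>

lemma finite_poly_index: "finite (poly_index n s)"
  by (simp add: poly_index_def)

lemma dual_vec_basis:
  assumes "basis_of T I b" "k \<in> I" "l \<in> I"
  shows "dual_vec I b k (b l) = (if k = l then 1 else 0)"
proof -
  \<comment> \<open>\<open>representation\<close> is indexed by vectors and \<open>dual_vec\<close>
    by indices; injectivity of \<open>b\<close> lets one pass between them.\<close>
  have "b l = b k \<longleftrightarrow> k = l"
    using assms inj_on_eq_iff[of b I l k] unfolding basis_of_def by blast
  moreover have "representation (b ` I) (b l) = (\<lambda>v. if v = b l then 1 else 0)"
    using assms unfolding basis_of_def by (intro representation_basis) blast+
  ultimately show ?thesis
    unfolding dual_vec_def by (cases "k = l") simp_all
qed

lemma basis_of_in_space: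
  assumes "basis_of T I b" "k \<in> I"
  shows "b k \<in> T"
proof -
  have "b k \<in> span (b ` I)"
    by (rule span_base[OF imageI[OF assms(2)]])
  then show ?thesis using assms(1) unfolding basis_of_def by blast
qed

lemma dual_vec_outside:
  assumes "basis_of T I b" "u \<notin> T"
  shows "dual_vec I b k u = 0"
proof -
  have "u \<notin> span (b ` I)" using assms unfolding basis_of_def by blast
  then show ?thesis unfolding dual_vec_def representation_def by (simp only: if_False simp_thms)
qed

lemma dual_vec_combine:
  assumes "basis_of T I b" "u \<in> T" "v \<in> T"
  shows "dual_vec I b k (r *\<^sub>R u + v) = r * dual_vec I b k u + dual_vec I b k v"
proof -
  have ind: "independent (b ` I)" and u: "u \<in> span (b ` I)" and v: "v \<in> span (b ` I)"
    using assms unfolding basis_of_def by blast+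
  show ?thesis
    unfolding dual_vec_def representation_add[OF ind v span_scale[OF u]] representation_scale[OF ind u] ..
qed

lemma sum_dual_vec:
  assumes "basis_of T I b" "finite I" "u \<in> T"
  shows "(\<Sum>k\<in>I. dual_vec I b k u *\<^sub>R b k) = u"
proof -
  have b: "inj_on b I" "independent (b ` I)" "u \<in> span (b ` I)"
    using assms unfolding basis_of_def by blast+
  have "(\<Sum>x\<in>b ` I. representation (b ` I) u x *\<^sub>R x) = u"
    by (rule sum_representation_eq[OF b(2,3) finite_imageI[OF assms(2)] order_refl])
  then show ?thesis
    unfolding sum.reindex[OF b(1)] comp_def dual_vec_def .
qed

lemma
  assumes "bilinear_on T g" "subspace T" "finite I" "basis_of T I b" "orthonormal_family g I b"
  shows orthonormal_coordinate_left: "u \<in> T \<Longrightarrow> k \<in> I \<Longrightarrow> g u (b k) = dual_vec I b k u"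
    and orthonormal_Parseval:
      "u \<in> T \<Longrightarrow> v \<in> T \<Longrightarrow> g u v = (\<Sum>k\<in>I. dual_vec I b k u * dual_vec I b k v)"
proof -
  note b = basis_of_in_space[OF assms(4)]
  have expand: "g' u w = (\<Sum>k\<in>I. dual_vec I b k u * g' (b k) w)"
    if "bilinear_on T g'" "u \<in> T" "w \<in> T" for g' u w
  proof -
    have "g' (\<Sum>k\<in>I. dual_vec I b k u *\<^sub>R b k) w = (\<Sum>k\<in>I. dual_vec I b k u * g' (b k) w)"
      by (rule bilinear_on_sum_left[OF that(1) assms(2,3) _ that(3)]) (rule b)
    then show ?thesis unfolding sum_dual_vec[OF assms(4,3) that(2)] .
  qed
  \<comment> \<open>Stated for an arbitrary form \<open>g'\<close> because it is used twice: for
    \<open>g\<close>, and for its transpose, which yields the coordinates in the second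
    argument.\<close>
  have coord: "g' u (b k) = dual_vec I b k u"
    if g': "bilinear_on T g'" "orthonormal_family g' I b" and u: "u \<in> T" and k: "k \<in> I" for g' u k
  proof -
    have "dual_vec I b l u * g' (b l) (b k) = (if l = k then dual_vec I b l u else 0)" if "l \<in> I" for l
      using g'(2) that k unfolding orthonormal_family_def by simp
    then have "g' u (b k) = (\<Sum>l\<in>I. if l = k then dual_vec I b l u else 0)"
      unfolding expand[OF g'(1) u b[OF k]] by (rule sum.cong[OF refl])
    then show ?thesis using assms(3) k by simp
  qed
  show "g u (b k) = dual_vec I b k u" if "u \<in> T" "k \<in> I" for u k
    by (rule coord[OF assms(1,5) that])
  have "bilinear_on T (\<lambda>u v. g v u)"
    using assms(1) unfolding bilinear_on_def by blast
  moreover have "orthonormal_family (\<lambda>u v. g v u) I b"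
    using assms(5) unfolding orthonormal_family_def by simp
  ultimately have right: "g (b k) u = dual_vec I b k u" if "u \<in> T" "k \<in> I" for u k
    using that by (rule coord)
  show "g u v = (\<Sum>k\<in>I. dual_vec I b k u * dual_vec I b k v)" if "u \<in> T" "v \<in> T" for u v
    unfolding expand[OF assms(1) that] by (rule sum.cong[OF refl]) (simp only: right[OF that(2)])
qed

text \<open>With \<open>A\<^sub>j\<close> denoting the endomorphism that is \<open>g\<close>-dual to \<open>\<omega>\<^sub>j\<close>, one has \<open>A\<^sub>j v\<^sub>i = w\<^sub>i\<^sup>j\<close>,
  \<open>A\<^sub>j w\<^sub>i\<^sup>j = - v\<^sub>i\<close>, and \<open>A\<^sub>j\<close> vanishes on the remaining basis vectors.\<close>

lemma standard_form_dual_coordinates: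
  assumes "bilinear_on T g" "subspace T" "standard_basis T n s \<omega> b"
    and "orthonormal_family g (poly_index n s) b"
    and "j \<in> {1..s}" "u \<in> T" "u' \<in> T" "\<forall>w\<in>T. g u' w = \<omega> j u w" "l \<in> {1..n}"
  shows "m \<in> {0..s} \<Longrightarrow> dual_vec (poly_index n s) b (m, l) u' =
    (if m = 0 then - dual_vec (poly_index n s) b (j, l) u
     else if m = j then dual_vec (poly_index n s) b (0, l) u else 0)"
proof -
  let ?I = "poly_index n s"
  let ?d = "dual_vec ?I b"
  assume m: "m \<in> {0..s}"
  have bas: "basis_of T ?I b" using assms(3) by (simp add: standard_basis_def)
  have k: "(m, l) \<in> ?I" using assms(9) m by (simp add: poly_index_def)
  have d: "?d (m', i) (b (m, l)) = (if m' = m then if i = l then 1 else 0 else 0)"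
    if "m' \<in> {0..s}" "i \<in> {1..n}" for m' i
    using dual_vec_basis[OF bas _ k, of "(m', i)"] that by (simp add: poly_index_def)
  have "?d (m, l) u' = g u' (b (m, l))"
    by (rule orthonormal_coordinate_left[OF assms(1,2) finite_poly_index bas assms(4,7) k, symmetric])
  also have "\<dots> = \<omega> j u (b (m, l))"
    using assms(8) basis_of_in_space[OF bas k] by blast
  also have "\<dots> = (\<Sum>i = 1..n. wedge (?d (0, i)) (?d (j, i)) u (b (m, l)))"
    using assms(3,5,6) basis_of_in_space[OF bas k] unfolding standard_basis_def by blast
  \<comment> \<open>At a basis vector only the summand \<open>i = l\<close> survives. Since
    \<open>j \<ge> 1\<close>, the blocks \<open>0\<close> and \<open>j\<close> differ, so at most
    one product of the wedge is nonzero: the subtracted one for \<open>m = 0\<close>, the other for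
    \<open>m = j\<close>.\<close>
  also have "\<dots> = (\<Sum>i = 1..n. if i = l then
      (if m = 0 then - ?d (j, i) u else if m = j then ?d (0, i) u else 0) else 0)"
    using assms(5) by (intro sum.cong) (auto simp: wedge_def d)
  also have "\<dots> = (if m = 0 then - ?d (j, l) u else if m = j then ?d (0, l) u else 0)"
    using assms(9) by simp
  finally show ?thesis .
qed

text \<open>Let \<open>u\<close> have coordinate blocks \<open>(a0, a1, a2)\<close> and
  \<open>v\<close> blocks \<open>(c0, c1, c2)\<close>. Then \<open>u1\<close> has blocks
  \<open>(- a1, a0, 0)\<close> and \<open>v2\<close> has \<open>(- c2, 0, c0)\<close>. Only block 0
  contributes to \<open>g u1 v2\<close>, which is the sum of the \<open>a1 * c2\<close>; likewise
  \<open>g u2 v1\<close> is the sum of the \<open>a2 * c1\<close>, and the difference is the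
  wedge.\<close>

lemma dualizing_form_algebra:
  assumes "bilinear_on T g" "subspace T" "standard_basis T n 2 \<omega> b"
    and "orthonormal_family g (poly_index n 2) b" "u \<in> T" "v \<in> T"
    and u1: "u1 \<in> T" "\<forall>w\<in>T. g u1 w = \<omega> 1 u w" and u2: "u2 \<in> T" "\<forall>w\<in>T. g u2 w = \<omega> 2 u w"
    and v1: "v1 \<in> T" "\<forall>w\<in>T. g v1 w = \<omega> 1 v w" and v2: "v2 \<in> T" "\<forall>w\<in>T. g v2 w = \<omega> 2 v w"
  shows "(\<Sum>i = 1..n. wedge (dual_vec (poly_index n 2) b (1, i)) (dual_vec (poly_index n 2) b (2, i)) u v)
    = g u1 v2 - g u2 v1"
proof -
  let ?I = "poly_index n 2"
  let ?d = "dual_vec ?I b"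
  have bas: "basis_of T ?I b" using assms(3) by (simp add: standard_basis_def)
  have Parseval: "g x y = (\<Sum>i = 1..n. ?d (0, i) x * ?d (0, i) y + ?d (1, i) x * ?d (1, i) y
      + ?d (2, i) x * ?d (2, i) y)" if "x \<in> T" "y \<in> T" for x y
  proof -
    have "g x y = (\<Sum>k\<in>{0..2} \<times> {1..n}. ?d k x * ?d k y)"
      using orthonormal_Parseval[OF assms(1,2) finite_poly_index bas assms(4) that]
      by (simp only: poly_index_def)
    also have "\<dots> = (\<Sum>m = 0..2. \<Sum>i = 1..n. ?d (m, i) x * ?d (m, i) y)"
      by (simp add: sum.cartesian_product)
    also have "{0..2::nat} = {0, 1, 2}" by auto
    finally show ?thesis by (simp add: sum.distrib)
  qed
  note coords = standard_form_dual_coordinates[OF assms(1-4)]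
  have "g u1 v2 = (\<Sum>i = 1..n. ?d (1, i) u * ?d (2, i) v)"
    unfolding Parseval[OF u1(1) v2(1)]
    using coords[OF _ assms(5) u1] coords[OF _ assms(6) v2] by (intro sum.cong) simp_all
  moreover have "g u2 v1 = (\<Sum>i = 1..n. ?d (2, i) u * ?d (1, i) v)"
    unfolding Parseval[OF u2(1) v1(1)]
    using coords[OF _ assms(5) u2] coords[OF _ assms(6) v1] by (intro sum.cong) simp_all
  ultimately show ?thesis
    by (simp add: wedge_def sum_subtractf mult.commute)
qed

section \<open>Bilinear fields and vector fields in charts\<close>

lemma charts_atD: "c \<in> charts_at A p \<Longrightarrow> c \<in> A" "c \<in> charts_at A p \<Longrightarrow> p \<in> fst c"
  by (simp_all add: charts_at_def)

lemma chart_im_at: "c \<in> charts_at A p \<Longrightarrow> snd c p \<in> chart_im c"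
  by (simp add: charts_at_def)

lemma chart_inv_chart:
  assumes "smooth_manifold X A" "c \<in> charts_at A p"
  shows "chart_inv c (snd c p) = p"
  using inv_into_f_f[OF inj_on_chart[OF assms(1)]] assms(2) by (simp add: charts_at_def)

lemma charts_at_chart_inv: "c \<in> A \<Longrightarrow> x \<in> chart_im c \<Longrightarrow> c \<in> charts_at A (chart_inv c x)"
  by (simp add: charts_at_def inv_into_into)

lemma chart_chart_inv: "x \<in> chart_im c \<Longrightarrow> snd c (chart_inv c x) = x"
  by (rule f_inv_into_f)

lemma charts_at_imp_topspace:
  assumes "smooth_manifold X A" "c \<in> charts_at A p"
  shows "p \<in> topspace X"
  using chart_subset_topspace[OF assms(1) charts_atD(1)[OF assms(2)]] charts_atD(2)[OF assms(2)] by blast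

lemma charts_at_nonempty:
  assumes "smooth_manifold X A" "p \<in> topspace X"
  shows "\<exists>c. c \<in> charts_at A p"
  using assms unfolding smooth_manifold_def charts_at_def by blast

text \<open>The pullback of \<open>\<beta>\<close> under the inverse chart: a family of forms on the
  model space to which the Euclidean lemmas on smooth coefficients apply.\<close>

definition coord_form ::
  "('a, 'e::euclidean_space) chart set \<Rightarrow> ('a, 'e) chart \<Rightarrow> ('a \<Rightarrow> ('a, 'e) bform) \<Rightarrow> 'e \<Rightarrow> 'e \<Rightarrow> 'e \<Rightarrow> real"
  where "coord_form A c \<beta> x a b =
    \<beta> (chart_inv c x) (coord_tvec A c (chart_inv c x) a) (coord_tvec A c (chart_inv c x) b)"

lemma smooth_bilinear_field_bilinear_on:
  "smooth_bilinear_field X A \<beta> \<Longrightarrow> p \<in> topspace X \<Longrightarrow> bilinear_on (tangent_space A p) (\<beta> p)"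
  unfolding smooth_bilinear_field_def by blast

lemma smooth_coord_form:
  assumes "smooth_bilinear_field X A \<beta>" "c \<in> A"
  shows "smooth_on (chart_im c) (\<lambda>x. coord_form A c \<beta> x a b)"
  using assms unfolding smooth_bilinear_field_def coord_form_def Let_def by blast

lemma bilinear_coord_form:
  assumes "smooth_manifold X A" "smooth_bilinear_field X A \<beta>" "c \<in> A" "x \<in> chart_im c"
  shows "bilinear (coord_form A c \<beta> x)"
proof -
  let ?p = "chart_inv c x"
  have c: "c \<in> charts_at A ?p" using charts_at_chart_inv assms(3,4) .
  note bil = smooth_bilinear_field_bilinear_on[OF assms(2) charts_at_imp_topspace[OF assms(1) c]]
  note T = coord_tvec_in_tangent_space[OF assms(1) c]
  note lin = linear_coord_tvec[OF assms(1) c]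
  note sub = tangent_space_subspace[OF assms(1)]
  show ?thesis
    unfolding bilinear_def
  proof (intro conjI allI linearI)
    show "coord_form A c \<beta> x a (b + b') = coord_form A c \<beta> x a b + coord_form A c \<beta> x a b'" for a b b'
      unfolding coord_form_def linear_add[OF lin] by (rule bilinear_on_add(2)[OF bil T T T])
    show "coord_form A c \<beta> x (b + b') a = coord_form A c \<beta> x b a + coord_form A c \<beta> x b' a" for a b b'
      unfolding coord_form_def linear_add[OF lin] by (rule bilinear_on_add(1)[OF bil T T T])
    show "coord_form A c \<beta> x a (r *\<^sub>R b) = r *\<^sub>R coord_form A c \<beta> x a b" for a b r
      unfolding coord_form_def linear_cmul[OF lin] real_scaleR_def
      by (rule bilinear_on_scaleR(2)[OF bil sub T T])
    show "coord_form A c \<beta> x (r *\<^sub>R b) a = r *\<^sub>R coord_form A c \<beta> x b a" for a b r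
      unfolding coord_form_def linear_cmul[OF lin] real_scaleR_def
      by (rule bilinear_on_scaleR(1)[OF bil sub T T])
  qed
qed

lemma coord_form_coordinates:
  assumes "smooth_manifold X A" "c \<in> charts_at A p" "u \<in> tangent_space A p" "v \<in> tangent_space A p"
  shows "coord_form A c \<beta> (snd c p) (u c) (v c) = \<beta> p u v"
  unfolding coord_form_def chart_inv_chart[OF assms(1,2)]
    coord_tvec_of_coordinates[OF assms(2,3)] coord_tvec_of_coordinates[OF assms(2,4)] ..

section \<open>Smooth vector fields and the functions obtained by pairing them\<close>

lemma smooth_vfieldD:
  assumes "smooth_vfield A Y"
  shows smooth_vfield_in_tangent_space: "Y p \<in> tangent_space A p"
    and smooth_vfield_coordinates: "c \<in> A \<Longrightarrow> smooth_on (chart_im c) (\<lambda>x. Y (chart_inv c x) c)"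
  using assms unfolding smooth_vfield_def by blast+

lemma smooth_vfield_diff:
  assumes "smooth_manifold X A" "smooth_vfield A Y" "smooth_vfield A Z"
  shows "smooth_vfield A (\<lambda>p. Y p - Z p)"
  unfolding smooth_vfield_def
proof (intro conjI allI ballI)
  show "Y p - Z p \<in> tangent_space A p" for p
    by (rule subspace_diff[OF tangent_space_subspace[OF assms(1)]
          smooth_vfield_in_tangent_space[OF assms(2)] smooth_vfield_in_tangent_space[OF assms(3)]])
  show "smooth_on (chart_im c) (\<lambda>x. (Y (chart_inv c x) - Z (chart_inv c x)) c)" if "c \<in> A" for c
    unfolding minus_apply
    by (rule smooth_on_diff[OF open_chart_im[OF assms(1) that]
          smooth_vfield_coordinates[OF assms(2) that] smooth_vfield_coordinates[OF assms(3) that]])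
qed

lemma smooth_fun_bilinear_field:
  assumes "smooth_manifold X A" "smooth_bilinear_field X A \<beta>" "smooth_vfield A Y" "smooth_vfield A Z"
  shows "smooth_fun A (\<lambda>q. \<beta> q (Y q) (Z q))"
  unfolding smooth_fun_def
proof
  fix c assume c: "c \<in> A"
  have "smooth_on (chart_im c)
    (\<lambda>x. coord_form A c \<beta> x (Y (chart_inv c x) c) (Z (chart_inv c x) c))"
    by (rule smooth_on_bilinear_coefficients[OF open_chart_im[OF assms(1) c]
          bilinear_coord_form[OF assms(1,2) c] smooth_coord_form[OF assms(2) c]
          smooth_vfield_coordinates[OF assms(3) c] smooth_vfield_coordinates[OF assms(4) c]])
  then show "smooth_on (chart_im c) ((\<lambda>q. \<beta> q (Y q) (Z q)) \<circ> chart_inv c)"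
  proof (rule smooth_on_cong[OF open_chart_im[OF assms(1) c]])
    fix x assume x: "x \<in> chart_im c"
    show "coord_form A c \<beta> x (Y (chart_inv c x) c) (Z (chart_inv c x) c)
      = ((\<lambda>q. \<beta> q (Y q) (Z q)) \<circ> chart_inv c) x"
      using coord_form_coordinates[OF assms(1) charts_at_chart_inv[OF c x]
          smooth_vfield_in_tangent_space[OF assms(3)] smooth_vfield_in_tangent_space[OF assms(4)], of \<beta>]
      unfolding chart_chart_inv[OF x] comp_def .
  qed
qed

section \<open>Directional derivatives\<close>

lemma some_chart_at:
  assumes "smooth_manifold X A" "p \<in> topspace X"
  shows "(SOME c. c \<in> charts_at A p) \<in> charts_at A p"
  by (rule someI_ex[OF charts_at_nonempty[OF assms]])

text \<open>Both derivatives are computed in the same chosen chart, whose image is open and whose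
  domain lies in the manifold. Agreement on \<open>topspace X\<close> is therefore agreement near
  the point.\<close>

lemma dir_deriv_cong:
  assumes "smooth_manifold X A" "p \<in> topspace X" "\<And>q. q \<in> topspace X \<Longrightarrow> f q = h q"
  shows "dir_deriv A p v f = dir_deriv A p v h"
proof -
  define c where "c = (SOME c. c \<in> charts_at A p)"
  have c: "c \<in> charts_at A p" unfolding c_def by (rule some_chart_at[OF assms(1,2)])
  have "frechet_derivative (f \<circ> chart_inv c) (at (snd c p)) = frechet_derivative (h \<circ> chart_inv c) (at (snd c p))"
  proof (rule frechet_derivative_cong_open[OF open_chart_im[OF assms(1) charts_atD(1)[OF c]] chart_im_at[OF c]])
    fix x assume "x \<in> chart_im c"
    from charts_at_imp_topspace[OF assms(1) charts_at_chart_inv[OF charts_atD(1)[OF c] this]]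
    show "(f \<circ> chart_inv c) x = (h \<circ> chart_inv c) x"
      unfolding comp_def by (rule assms(3))
  qed
  then show ?thesis unfolding dir_deriv_def Let_def c_def[symmetric] by simp
qed

lemma dir_deriv_diff:
  assumes "smooth_manifold X A" "p \<in> topspace X" "smooth_fun A f" "smooth_fun A h"
  shows "dir_deriv A p v (\<lambda>q. f q - h q) = dir_deriv A p v f - dir_deriv A p v h"
proof -
  define c where "c = (SOME c. c \<in> charts_at A p)"
  have c: "c \<in> charts_at A p" unfolding c_def by (rule some_chart_at[OF assms(1,2)])
  let ?D = "\<lambda>f. frechet_derivative (f \<circ> chart_inv c) (at (snd c p))"
  have D: "(f \<circ> chart_inv c has_derivative ?D f) (at (snd c p))" if "smooth_fun A f" for f
  proof -
    have "smooth_on (chart_im c) (f \<circ> chart_inv c)"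
      using that charts_atD(1)[OF c] unfolding smooth_fun_def by blast
    from smooth_on_imp_differentiable[OF this chart_im_at[OF c]]
    show ?thesis unfolding frechet_derivative_works .
  qed
  have "((\<lambda>q. f q - h q) \<circ> chart_inv c has_derivative (\<lambda>v. ?D f v - ?D h v)) (at (snd c p))"
    using has_derivative_diff[OF D[OF assms(3)] D[OF assms(4)]] unfolding comp_def .
  from fun_cong[OF frechet_derivative_at[OF this], of "v c"]
  show ?thesis unfolding dir_deriv_def Let_def c_def[symmetric] by simp
qed

section \<open>Raising an index of a bilinear field\<close>

lemma riemannian_metric_smooth: "riemannian_metric X A g \<Longrightarrow> smooth_bilinear_field X A g"
  unfolding riemannian_metric_def by blast

lemma riemannian_metric_pos:
  assumes "riemannian_metric X A g" "p \<in> topspace X" "u \<in> tangent_space A p" "u \<noteq> 0"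
  shows "g p u u > 0"
  using assms unfolding riemannian_metric_def by blast

text \<open>Positive definiteness at \<open>u - v\<close>. A single test vector suffices, and it is
  the difference itself; the comparison of covariant derivatives below relies on this.\<close>

lemma riemannian_metric_cancel:
  assumes "smooth_manifold X A" "riemannian_metric X A g" "p \<in> topspace X"
    and "u \<in> tangent_space A p" "v \<in> tangent_space A p" "g p u (u - v) = g p v (u - v)"
  shows "u = v"
proof (rule ccontr)
  assume "u \<noteq> v"
  then have "u - v \<noteq> 0" by simp
  note T = subspace_diff[OF tangent_space_subspace[OF assms(1)] assms(4,5)]
  from riemannian_metric_pos[OF assms(2,3) T \<open>u - v \<noteq> 0\<close>]
  have "g p (u - v) (u - v) > 0" .
  moreover have "g p (u - v) (u - v) = g p u (u - v) - g p v (u - v)"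
    by (rule bilinear_on_diff(1)[OF smooth_bilinear_field_bilinear_on[OF
            riemannian_metric_smooth[OF assms(2)] assms(3)] assms(4,5) T])
  ultimately show False using assms(6) by simp
qed

text \<open>Riesz representation with respect to the coordinate form of \<open>g\<close>. The input
  \<open>H\<close> is a map on the chart image rather than a vector field, so that coordinates of
  fields and constant vectors are both admissible.\<close>

lemma raise_index_in_chart:
  assumes "smooth_manifold X A" "riemannian_metric X A g" "smooth_bilinear_field X A \<beta>"
    and c: "c \<in> A" and H: "smooth_on (chart_im c) H"
  obtains F where "smooth_on (chart_im c) F"
    and "\<And>p w. p \<in> fst c \<Longrightarrow> w \<in> tangent_space A p \<Longrightarrow>
      g p (coord_tvec A c p (F (snd c p))) w = \<beta> p (coord_tvec A c p (H (snd c p))) w"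
proof -
  note op = open_chart_im[OF assms(1) c]
  note g = riemannian_metric_smooth[OF assms(2)]
  have pos: "coord_form A c g x a a > 0" if x: "x \<in> chart_im c" and "a \<noteq> 0" for x a
  proof -
    note cx = charts_at_chart_inv[OF c x]
    have "coord_tvec A c (chart_inv c x) a \<noteq> 0"
    proof
      assume "coord_tvec A c (chart_inv c x) a = 0"
      with coord_tvec_same_chart[OF assms(1) cx, of a] \<open>a \<noteq> 0\<close> show False by simp
    qed
    with riemannian_metric_pos[OF assms(2) charts_at_imp_topspace[OF assms(1) cx]
        coord_tvec_in_tangent_space[OF assms(1) cx]]
    show ?thesis unfolding coord_form_def by blast
  qed
  have lin: "linear (coord_form A c \<beta> x (H x))" if "x \<in> chart_im c" for x
    using bilinear_coord_form[OF assms(1,3) c that] unfolding bilinear_def by blast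
  have sm: "smooth_on (chart_im c) (\<lambda>x. coord_form A c \<beta> x (H x) b)" for b
    by (rule smooth_on_bilinear_coefficients[OF op bilinear_coord_form[OF assms(1,3) c]
          smooth_coord_form[OF assms(3) c] H smooth_on_const[OF op]])
  have "\<exists>F. smooth_on (chart_im c) F \<and>
    (\<forall>x\<in>chart_im c. \<forall>b. coord_form A c g x (F x) b = coord_form A c \<beta> x (H x) b)"
    by (rule smooth_Riesz_representative[OF op bilinear_coord_form[OF assms(1) g c]
          smooth_coord_form[OF g c] pos lin sm])
  then obtain F where F: "smooth_on (chart_im c) F"
    "\<And>x b. x \<in> chart_im c \<Longrightarrow> coord_form A c g x (F x) b = coord_form A c \<beta> x (H x) b"
    by blast
  show thesis
  proof (rule that[OF F(1)])
    fix p w assume p: "p \<in> fst c" and w: "w \<in> tangent_space A p"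
    have cp: "c \<in> charts_at A p" using c p by (simp add: charts_at_def)
    show "g p (coord_tvec A c p (F (snd c p))) w = \<beta> p (coord_tvec A c p (H (snd c p))) w"
      using F(2)[OF chart_im_at[OF cp], of "w c"]
      unfolding coord_form_def chart_inv_chart[OF assms(1) cp] coord_tvec_of_coordinates[OF cp w] .
  qed
qed

text \<open>The vector is continued over a chart with constant coordinates, and only the value at
  \<open>p\<close> of the resulting solution is kept.\<close>

lemma raise_index_pointwise:
  assumes "smooth_manifold X A" "riemannian_metric X A g" "smooth_bilinear_field X A \<beta>"
    and p: "p \<in> topspace X" and u: "u \<in> tangent_space A p"
  obtains u' where "u' \<in> tangent_space A p" "\<forall>w\<in>tangent_space A p. g p u' w = \<beta> p u w"
proof -
  obtain c where c: "c \<in> charts_at A p" using charts_at_nonempty[OF assms(1) p] by blast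
  note cA = charts_atD[OF c]
  obtain F where F: "\<And>q w. q \<in> fst c \<Longrightarrow> w \<in> tangent_space A q \<Longrightarrow>
      g q (coord_tvec A c q (F (snd c q))) w = \<beta> q (coord_tvec A c q (u c)) w"
    using raise_index_in_chart[OF assms(1-3) cA(1) smooth_on_const[OF open_chart_im[OF assms(1) cA(1)]]]
    by blast
  show thesis
    using F[OF cA(2)] unfolding coord_tvec_of_coordinates[OF c u]
    by (intro that[OF coord_tvec_in_tangent_space[OF assms(1) c]] ballI)
qed

text \<open>The field is defined by a pointwise choice. Since \<open>g\<close> determines the raised
  vector uniquely, the choice coincides in every chart with the smooth local solution.\<close>

lemma raise_index_vfield:
  assumes "smooth_manifold X A" "riemannian_metric X A g" "smooth_bilinear_field X A \<beta>"
    and Z: "smooth_vfield A Z"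
  obtains Z' where "smooth_vfield A Z'"
    and "\<And>p. p \<in> topspace X \<Longrightarrow> \<forall>w\<in>tangent_space A p. g p (Z' p) w = \<beta> p (Z p) w"
proof -
  define P where "P p u \<longleftrightarrow> u \<in> tangent_space A p \<and> (\<forall>w\<in>tangent_space A p. g p u w = \<beta> p (Z p) w)" for p u
  \<comment> \<open>Off the manifold the tangent space is \<open>{0}\<close>, which forces the value
    \<open>0\<close>.\<close>
  define Z' where "Z' p = (if p \<in> topspace X then SOME u. P p u else 0)" for p
  note ZT = smooth_vfield_in_tangent_space[OF Z]
  have Z': "P p (Z' p)" if "p \<in> topspace X" for p
  proof -
    have "\<exists>u. P p u"
      using raise_index_pointwise[OF assms(1-3) that ZT] unfolding P_def by blast
    from someI_ex[OF this] show ?thesis unfolding Z'_def using that by simp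
  qed
  have unique: "u = v" if "p \<in> topspace X" "P p u" "P p v" for p u v
  proof (rule riemannian_metric_cancel[OF assms(1,2) that(1)])
    show u: "u \<in> tangent_space A p" and v: "v \<in> tangent_space A p"
      using that unfolding P_def by blast+
    show "g p u (u - v) = g p v (u - v)"
      using that subspace_diff[OF tangent_space_subspace[OF assms(1)] u v] unfolding P_def by simp
  qed
  have "smooth_vfield A Z'"
    unfolding smooth_vfield_def
  proof (intro conjI allI ballI)
    show "Z' p \<in> tangent_space A p" for p
    proof (cases "p \<in> topspace X")
      case True
      then show ?thesis using Z' unfolding P_def by blast
    next
      case False
      then show ?thesis using subspace_0[OF tangent_space_subspace[OF assms(1)]] by (simp add: Z'_def)
    qed
    fix c assume c: "c \<in> A"
    obtain F where F: "smooth_on (chart_im c) F"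
      "\<And>p w. p \<in> fst c \<Longrightarrow> w \<in> tangent_space A p \<Longrightarrow> g p (coord_tvec A c p (F (snd c p))) w
        = \<beta> p (coord_tvec A c p (Z (chart_inv c (snd c p)) c)) w"
      using raise_index_in_chart[OF assms(1-3) c smooth_vfield_coordinates[OF Z c]] by blast
    show "smooth_on (chart_im c) (\<lambda>x. Z' (chart_inv c x) c)"
    proof (rule smooth_on_cong[OF open_chart_im[OF assms(1) c] F(1)])
      fix x assume x: "x \<in> chart_im c"
      let ?p = "chart_inv c x"
      note cp = charts_at_chart_inv[OF c x]
      note p = charts_at_imp_topspace[OF assms(1) cp]
      have "P ?p (coord_tvec A c ?p (F x))"
        using F(2)[OF charts_atD(2)[OF cp]] coord_tvec_in_tangent_space[OF assms(1) cp]
        unfolding P_def chart_chart_inv[OF x] coord_tvec_of_coordinates[OF cp ZT] by blast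
      from unique[OF p Z'[OF p] this]
      show "F x = Z' ?p c"
        using coord_tvec_same_chart[OF assms(1) cp, of "F x"] by simp
    qed
  qed
  then show thesis using Z' unfolding P_def by (intro that) blast+
qed

section \<open>Parallel fields\<close>

lemma parallel_smooth: "parallel X A nabla \<beta> \<Longrightarrow> smooth_bilinear_field X A \<beta>"
  unfolding parallel_def by blast

lemma parallel_dir_deriv:
  assumes "parallel X A nabla \<beta>" "smooth_vfield A Y" "smooth_vfield A Z" "smooth_vfield A W"
    and "p \<in> topspace X"
  shows "dir_deriv A p (Y p) (\<lambda>q. \<beta> q (Z q) (W q)) = \<beta> p (nabla Y Z p) (W p) + \<beta> p (Z p) (nabla Y W p)"
proof -
  have "cov_deriv A nabla \<beta> Y Z W p = 0"
    using conjunct2[OF assms(1)[unfolded parallel_def], rule_format, of Y Z W p] assms(2-5) by simp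
  then show ?thesis unfolding cov_deriv_def by linarith
qed

lemma affine_connection_smooth:
  assumes "affine_connection X A nabla" "smooth_vfield A Y" "smooth_vfield A Z"
  shows "smooth_vfield A (nabla Y Z)"
  using conjunct1[OF assms(1)[unfolded affine_connection_def], rule_format, of Y Z] assms(2,3) by simp

text \<open>Testing the identity against its own defect, which is a smooth vector field, avoids
  the extension of tangent vectors to global vector fields.\<close>

lemma connection_commutes_with_raised_index:
  assumes "smooth_manifold X A" "riemannian_metric X A g" "affine_connection X A nabla"
    and "parallel X A nabla g" "parallel X A nabla \<beta>"
    and Y: "smooth_vfield A Y" and Z: "smooth_vfield A Z" and Z': "smooth_vfield A Z'"
    and raised: "\<And>p. p \<in> topspace X \<Longrightarrow> \<forall>w\<in>tangent_space A p. g p (Z' p) w = \<beta> p (Z p) w"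
    and p: "p \<in> topspace X"
  shows "\<forall>w\<in>tangent_space A p. g p (nabla Y Z' p) w = \<beta> p (nabla Y Z p) w"
proof -
  note conn = affine_connection_smooth[OF assms(3) Y]
  obtain V where V: "smooth_vfield A V"
    "\<And>p. p \<in> topspace X \<Longrightarrow> \<forall>w\<in>tangent_space A p. g p (V p) w = \<beta> p (nabla Y Z p) w"
    by (rule raise_index_vfield[OF assms(1,2) parallel_smooth[OF assms(5)] conn[OF Z]]) (rule that)
  define W where "W = (\<lambda>q. nabla Y Z' q - V q)"
  have W: "smooth_vfield A W"
    unfolding W_def by (rule smooth_vfield_diff[OF assms(1) conn[OF Z'] V(1)])
  note WT = smooth_vfield_in_tangent_space[OF W]
  \<comment> \<open>One function is differentiated in two ways, using that \<open>g\<close> and that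
    \<open>\<beta>\<close> are parallel. The terms containing \<open>nabla Y W\<close> agree because
    \<open>Z'\<close> is raised from \<open>Z\<close>, and what remains compares
    \<open>nabla Y Z'\<close> with \<open>V\<close> on the test field \<open>W\<close>.\<close>
  have "dir_deriv A p (Y p) (\<lambda>q. g q (Z' q) (W q)) = dir_deriv A p (Y p) (\<lambda>q. \<beta> q (Z q) (W q))"
  proof (rule dir_deriv_cong[OF assms(1) p])
    show "g q (Z' q) (W q) = \<beta> q (Z q) (W q)" if "q \<in> topspace X" for q
      by (rule bspec[OF raised[OF that] WT])
  qed
  moreover have "g p (Z' p) (nabla Y W p) = \<beta> p (Z p) (nabla Y W p)"
    by (rule bspec[OF raised[OF p] smooth_vfield_in_tangent_space[OF conn[OF W]]])
  ultimately have "g p (nabla Y Z' p) (W p) = \<beta> p (nabla Y Z p) (W p)"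
    unfolding parallel_dir_deriv[OF assms(4) Y Z' W p] parallel_dir_deriv[OF assms(5) Y Z W p] by simp
  also have "\<dots> = g p (V p) (W p)"
    by (rule bspec[OF V(2)[OF p] WT, symmetric])
  finally have "nabla Y Z' p = V p"
    unfolding W_def
    by (rule riemannian_metric_cancel[OF assms(1,2) p smooth_vfield_in_tangent_space[OF conn[OF Z']]
          smooth_vfield_in_tangent_space[OF V(1)]])
  then show ?thesis using V(2)[OF p] by (simp only:)
qed

text \<open>Parallelism turns the three derivatives in \<open>ext_deriv\<close> into six terms, and
  vanishing torsion turns the three brackets into six more. Once antisymmetry moves every covariant
  derivative into the first argument, the twelve terms cancel in pairs.\<close>

lemma parallel_two_form_closed:
  assumes "smooth_manifold X A" "affine_connection X A nabla" "torsion_free X A nabla"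
    and par: "parallel X A nabla \<beta>" and two: "two_form X A \<beta>"
  shows "closed_two_form X A \<beta>"
  unfolding closed_two_form_def
proof (intro conjI allI impI ballI)
  fix Y Z W p
  assume "smooth_vfield A Y \<and> smooth_vfield A Z \<and> smooth_vfield A W" and p: "p \<in> topspace X"
  then have Y: "smooth_vfield A Y" and Z: "smooth_vfield A Z" and W: "smooth_vfield A W" by blast+
  let ?T = "tangent_space A p"
  note bil = smooth_bilinear_field_bilinear_on[OF parallel_smooth[OF par] p]
  have alt: "alternating_on ?T (\<beta> p)" using two p unfolding two_form_def by blast
  note swap = alternating_on_swap[OF bil tangent_space_subspace[OF assms(1)] alt]
  have T: "nabla U V p \<in> ?T" if "smooth_vfield A U" "smooth_vfield A V" for U V
    by (rule smooth_vfield_in_tangent_space[OF affine_connection_smooth[OF assms(2) that]])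
  have bracket: "\<beta> p (lie_bracket A U V p) (S p) = \<beta> p (nabla U V p) (S p) - \<beta> p (nabla V U p) (S p)"
    if "smooth_vfield A U" "smooth_vfield A V" "smooth_vfield A S" for U V S
  proof -
    have "nabla U V p - nabla V U p = lie_bracket A U V p"
      using assms(3) that p unfolding torsion_free_def by blast
    from this[symmetric] show ?thesis
      using bilinear_on_diff(1)[OF bil T[OF that(1,2)] T[OF that(2,1)]
          smooth_vfield_in_tangent_space[OF that(3)]] by simp
  qed
  have "\<beta> p (U p) (nabla V S p) = - \<beta> p (nabla V S p) (U p)"
    if "smooth_vfield A U" "smooth_vfield A V" "smooth_vfield A S" for U V S
    by (rule swap[OF smooth_vfield_in_tangent_space[OF that(1)] T[OF that(2,3)]])
  note swaps = this[OF Z Y W] this[OF Y Z W] this[OF Y W Z]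
  show "ext_deriv A \<beta> Y Z W p = 0"
    unfolding ext_deriv_def bracket[OF Y Z W] bracket[OF Y W Z] bracket[OF Z W Y]
      parallel_dir_deriv[OF par Y Z W p] parallel_dir_deriv[OF par Z Y W p]
      parallel_dir_deriv[OF par W Y Z p] swaps by simp
qed (fact two)

section \<open>The dualizing form\<close>

lemma almost_kahlerD:
  assumes "almost_kahler X A n s \<omega> g"
  shows almost_kahler_manifold: "smooth_manifold X A"
    and almost_kahler_metric: "riemannian_metric X A g"
    and almost_kahler_smooth: "j \<in> {1..s} \<Longrightarrow> smooth_bilinear_field X A (\<omega> j)"
    and almost_kahler_basis: "p \<in> topspace X \<Longrightarrow> \<exists>b. orthonormal_standard_basis A n s \<omega> g p b"
  using assms
  unfolding almost_kahler_def polysymplectic_manifold_def closed_two_form_def two_form_def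
  by blast+

text \<open>Written exactly as the function inside \<open>dualizing_form\<close>, so that folding it
  turns the definite description into a statement about bases.\<close>

definition basis_dualizing_form :: "nat \<Rightarrow> (nat \<times> nat \<Rightarrow> 'v::real_vector) \<Rightarrow> 'v \<Rightarrow> 'v \<Rightarrow> real" where
  "basis_dualizing_form n b = (\<lambda>u v. \<Sum>i = 1..n. wedge (dual_vec (poly_index n 2) b (1, i))
                                      (dual_vec (poly_index n 2) b (2, i)) u v)"

text \<open>Every product in the wedge has a factor evaluated at the outside argument, and
  \<open>representation\<close> is zero off the span.\<close>

lemma basis_dualizing_form_outside:
  assumes "basis_of T (poly_index n 2) b" "u \<notin> T \<or> v \<notin> T"
  shows "basis_dualizing_form n b u v = 0"
proof -
  have "wedge (dual_vec (poly_index n 2) b k) (dual_vec (poly_index n 2) b l) u v = 0" for k l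
    using assms(2) dual_vec_outside[OF assms(1), of u] dual_vec_outside[OF assms(1), of v]
    unfolding wedge_def by (elim disjE) simp_all
  then show ?thesis unfolding basis_dualizing_form_def by simp
qed

lemma bilinear_on_basis_dualizing_form:
  assumes "basis_of T (poly_index n 2) b"
  shows "bilinear_on T (basis_dualizing_form n b)"
  unfolding bilinear_on_def
proof (intro ballI allI conjI)
  fix u v w r assume T: "u \<in> T" "v \<in> T" "w \<in> T"
  note combine = dual_vec_combine[OF assms T(1,2)]
  show "basis_dualizing_form n b (r *\<^sub>R u + v) w
    = r * basis_dualizing_form n b u w + basis_dualizing_form n b v w"
    unfolding basis_dualizing_form_def sum_distrib_left sum.distrib[symmetric] wedge_def combine
    by (rule sum.cong[OF refl]) (simp only: algebra_simps)
  show "basis_dualizing_form n b w (r *\<^sub>R u + v)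
    = r * basis_dualizing_form n b w u + basis_dualizing_form n b w v"
    unfolding basis_dualizing_form_def sum_distrib_left sum.distrib[symmetric] wedge_def combine
    by (rule sum.cong[OF refl]) (simp only: algebra_simps)
qed

lemma alternating_on_basis_dualizing_form: "alternating_on T (basis_dualizing_form n b)"
  by (simp add: alternating_on_def basis_dualizing_form_def wedge_def)

lemma orthonormal_standard_basis_basis_of:
  "orthonormal_standard_basis A n s \<omega> g p b \<Longrightarrow> basis_of (tangent_space A p) (poly_index n s) b"
  unfolding orthonormal_standard_basis_def standard_basis_def by blast

lemma basis_dualizing_form_eq:
  assumes ak: "almost_kahler X A n 2 \<omega> g" and p: "p \<in> topspace X"
    and b: "orthonormal_standard_basis A n 2 \<omega> g p b"
    and "u \<in> tangent_space A p" "v \<in> tangent_space A p"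
    and "u1 \<in> tangent_space A p" "\<forall>w\<in>tangent_space A p. g p u1 w = \<omega> 1 p u w"
    and "u2 \<in> tangent_space A p" "\<forall>w\<in>tangent_space A p. g p u2 w = \<omega> 2 p u w"
    and "v1 \<in> tangent_space A p" "\<forall>w\<in>tangent_space A p. g p v1 w = \<omega> 1 p v w"
    and "v2 \<in> tangent_space A p" "\<forall>w\<in>tangent_space A p. g p v2 w = \<omega> 2 p v w"
  shows "basis_dualizing_form n b u v = g p u1 v2 - g p u2 v1"
proof -
  note g = smooth_bilinear_field_bilinear_on[OF riemannian_metric_smooth[OF almost_kahler_metric[OF ak]] p]
  show ?thesis
    unfolding basis_dualizing_form_def
    by (rule dualizing_form_algebra[OF g tangent_space_subspace[OF almost_kahler_manifold[OF ak]]
          conjunct1[OF b[unfolded orthonormal_standard_basis_def]]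
          conjunct2[OF b[unfolded orthonormal_standard_basis_def]] assms(4-)])
qed

text \<open>The right-hand side of \<open>basis_dualizing_form_eq\<close> does not depend on the basis, so the
  description in the definition of the dualizing form determines it.\<close>

lemma dualizing_form_eq_basis:
  assumes ak: "almost_kahler X A n 2 \<omega> g" and p: "p \<in> topspace X"
    and b: "orthonormal_standard_basis A n 2 \<omega> g p b"
  shows "dualizing_form A n \<omega> g p = basis_dualizing_form n b"
  unfolding dualizing_form_def basis_dualizing_form_def[symmetric]
proof (rule the_equality)
  let ?T = "tangent_space A p"
  show "\<exists>b'. orthonormal_standard_basis A n 2 \<omega> g p b' \<and> basis_dualizing_form n b = basis_dualizing_form n b'"
    using b by blast
  fix \<alpha> assume "\<exists>b'. orthonormal_standard_basis A n 2 \<omega> g p b' \<and> \<alpha> = basis_dualizing_form n b'"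
  then obtain b' where b': "orthonormal_standard_basis A n 2 \<omega> g p b'"
    and \<alpha>: "\<alpha> = basis_dualizing_form n b'" by blast
  have raise: "\<exists>u'. u' \<in> ?T \<and> (\<forall>w\<in>?T. g p u' w = \<omega> j p u w)" if "j \<in> {1..2}" "u \<in> ?T" for j u
    using raise_index_pointwise[OF almost_kahler_manifold[OF ak] almost_kahler_metric[OF ak]
        almost_kahler_smooth[OF ak that(1)] p that(2)] by blast
  \<comment> \<open>The definite description requires equality of total functions. On the tangent
    space both values are given by the basis-free formula with the same raised vectors; elsewhere
    both are zero.\<close>
  have "basis_dualizing_form n b' u v = basis_dualizing_form n b u v" for u v
  proof (cases "u \<in> ?T \<and> v \<in> ?T")
    case True
    then have u: "u \<in> ?T" and v: "v \<in> ?T" by blast+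
    obtain u1 where u1: "u1 \<in> ?T" "\<forall>w\<in>?T. g p u1 w = \<omega> 1 p u w" using raise[OF _ u, of 1] by auto
    obtain u2 where u2: "u2 \<in> ?T" "\<forall>w\<in>?T. g p u2 w = \<omega> 2 p u w" using raise[OF _ u, of 2] by auto
    obtain v1 where v1: "v1 \<in> ?T" "\<forall>w\<in>?T. g p v1 w = \<omega> 1 p v w" using raise[OF _ v, of 1] by auto
    obtain v2 where v2: "v2 \<in> ?T" "\<forall>w\<in>?T. g p v2 w = \<omega> 2 p v w" using raise[OF _ v, of 2] by auto
    show ?thesis
      unfolding basis_dualizing_form_eq[OF ak p b u v u1 u2 v1 v2]
        basis_dualizing_form_eq[OF ak p b' u v u1 u2 v1 v2] ..
  next
    case False
    then have "u \<notin> ?T \<or> v \<notin> ?T" by blast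
    then show ?thesis
      using basis_dualizing_form_outside orthonormal_standard_basis_basis_of b b' by metis
  qed
  then show "\<alpha> = basis_dualizing_form n b" unfolding \<alpha> by (intro ext)
qed

text \<open>The raised vectors are arbitrary arguments characterized by \<open>g\<close>, so that
  values of coordinate solutions, of raised fields and of their covariant derivatives can all be
  inserted.\<close>

lemma dualizing_form_eq:
  assumes ak: "almost_kahler X A n 2 \<omega> g" and p: "p \<in> topspace X"
    and "u \<in> tangent_space A p" "v \<in> tangent_space A p"
    and "u1 \<in> tangent_space A p" "\<forall>w\<in>tangent_space A p. g p u1 w = \<omega> 1 p u w"
    and "u2 \<in> tangent_space A p" "\<forall>w\<in>tangent_space A p. g p u2 w = \<omega> 2 p u w"
    and "v1 \<in> tangent_space A p" "\<forall>w\<in>tangent_space A p. g p v1 w = \<omega> 1 p v w"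
    and "v2 \<in> tangent_space A p" "\<forall>w\<in>tangent_space A p. g p v2 w = \<omega> 2 p v w"
  shows "dualizing_form A n \<omega> g p u v = g p u1 v2 - g p u2 v1"
proof -
  obtain b where b: "orthonormal_standard_basis A n 2 \<omega> g p b"
    using almost_kahler_basis[OF ak p] by blast
  show ?thesis
    unfolding dualizing_form_eq_basis[OF ak p b] by (rule basis_dualizing_form_eq[OF ak p b assms(3-)])
qed

text \<open>Bilinearity and alternation are pointwise and follow from any basis. Smoothness comes
  from the basis-free formula, with constant coordinate vectors raised smoothly in the
  chart.\<close>

lemma two_form_dualizing_form:
  assumes ak: "almost_kahler X A n 2 \<omega> g"
  shows "two_form X A (dualizing_form A n \<omega> g)"
  unfolding two_form_def smooth_bilinear_field_def Let_def
proof (intro conjI ballI allI)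
  note mf = almost_kahler_manifold[OF ak] and met = almost_kahler_metric[OF ak]
  note g = riemannian_metric_smooth[OF met]
  show "bilinear_on (tangent_space A p) (dualizing_form A n \<omega> g p)"
    and "alternating_on (tangent_space A p) (dualizing_form A n \<omega> g p)" if p: "p \<in> topspace X" for p
  proof -
    obtain b where b: "orthonormal_standard_basis A n 2 \<omega> g p b"
      using almost_kahler_basis[OF ak p] by blast
    show "bilinear_on (tangent_space A p) (dualizing_form A n \<omega> g p)"
      unfolding dualizing_form_eq_basis[OF ak p b]
      by (rule bilinear_on_basis_dualizing_form[OF orthonormal_standard_basis_basis_of[OF b]])
    show "alternating_on (tangent_space A p) (dualizing_form A n \<omega> g p)"
      unfolding dualizing_form_eq_basis[OF ak p b] by (rule alternating_on_basis_dualizing_form)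
  qed
  fix c a b assume c: "c \<in> A"
  note op = open_chart_im[OF mf c]
  have raise: "\<exists>F. smooth_on (chart_im c) F \<and> (\<forall>p\<in>fst c. \<forall>w\<in>tangent_space A p.
      g p (coord_tvec A c p (F (snd c p))) w = \<omega> j p (coord_tvec A c p a) w)"
    if "j \<in> {1..2}" for j a
    by (rule raise_index_in_chart[OF mf met almost_kahler_smooth[OF ak that] c smooth_on_const[OF op]])
      blast
  have "\<exists>F. \<forall>j\<in>{1..2::nat}. \<forall>a. smooth_on (chart_im c) (F j a) \<and> (\<forall>p\<in>fst c. \<forall>w\<in>tangent_space A p.
      g p (coord_tvec A c p (F j a (snd c p))) w = \<omega> j p (coord_tvec A c p a) w)"
    by (intro exI[of _ "\<lambda>j a. SOME F. smooth_on (chart_im c) F \<and> (\<forall>p\<in>fst c. \<forall>w\<in>tangent_space A p.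
      g p (coord_tvec A c p (F (snd c p))) w = \<omega> j p (coord_tvec A c p a) w)"] ballI allI)
      (rule someI_ex[OF raise])
  then obtain F where smooth: "\<And>j a. j \<in> {1..2::nat} \<Longrightarrow> smooth_on (chart_im c) (F j a)"
    and F: "\<And>j a p. j \<in> {1..2} \<Longrightarrow> p \<in> fst c \<Longrightarrow> \<forall>w\<in>tangent_space A p.
      g p (coord_tvec A c p (F j a (snd c p))) w = \<omega> j p (coord_tvec A c p a) w"
    by blast
  have j: "1 \<in> {1..2::nat}" "2 \<in> {1..2::nat}" by simp_all
  have sm: "smooth_on (chart_im c) (\<lambda>x. coord_form A c g x (F i a x) (F j b x))"
    if "i \<in> {1..2}" "j \<in> {1..2}" for i j
    by (rule smooth_on_bilinear_coefficients[OF op bilinear_coord_form[OF mf g c] smooth_coord_form[OF g c]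
          smooth[OF that(1)] smooth[OF that(2)]])
  show "smooth_on (chart_im c) (\<lambda>x. dualizing_form A n \<omega> g (chart_inv c x)
      (coord_tvec A c (chart_inv c x) a) (coord_tvec A c (chart_inv c x) b))"
  proof (rule smooth_on_cong[OF op smooth_on_diff[OF op sm[OF j] sm[OF j(2,1)]]])
    fix x assume x: "x \<in> chart_im c"
    note cp = charts_at_chart_inv[OF c x]
    note T = coord_tvec_in_tangent_space[OF mf cp]
    note Fx = F[OF _ charts_atD(2)[OF cp], unfolded chart_chart_inv[OF x]]
    show "coord_form A c g x (F 1 a x) (F 2 b x) - coord_form A c g x (F 2 a x) (F 1 b x)
      = dualizing_form A n \<omega> g (chart_inv c x)
          (coord_tvec A c (chart_inv c x) a) (coord_tvec A c (chart_inv c x) b)"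
      unfolding coord_form_def
      by (rule dualizing_form_eq[OF ak charts_at_imp_topspace[OF mf cp] T T T Fx[OF j(1)] T Fx[OF j(2)]
            T Fx[OF j(1)] T Fx[OF j(2)], symmetric])
  qed
qed

theorem proposition2p9:
  fixes X :: "'a topology"
    and A :: "('a, 'e::euclidean_space) chart set"
    and \<omega> :: "nat \<Rightarrow> 'a \<Rightarrow> ('a, 'e) bform"
    and g :: "'a \<Rightarrow> ('a, 'e) bform"
    and nabla :: "('a, 'e) connection"
    and n :: nat
  assumes "almost_kahler X A n 2 \<omega> g"
    and "levi_civita X A g nabla"
    and "parallel X A nabla (\<omega> 1)"
    and "parallel X A nabla (\<omega> 2)"
  shows "parallel X A nabla (dualizing_form A n \<omega> g) \<and> weakly_self_dual X A n \<omega> g"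
proof -
  note ak = assms(1)
  note mf = almost_kahler_manifold[OF ak] and met = almost_kahler_metric[OF ak]
  note g = riemannian_metric_smooth[OF met]
  have conn: "affine_connection X A nabla" and tors: "torsion_free X A nabla" and gpar: "parallel X A nabla g"
    using assms(2) unfolding levi_civita_def by simp_all
  let ?\<omega>D = "dualizing_form A n \<omega> g"
  have flat: "cov_deriv A nabla ?\<omega>D Y Z W p = 0"
    if Y: "smooth_vfield A Y" and Z: "smooth_vfield A Z" and W: "smooth_vfield A W"
      and p: "p \<in> topspace X" for Y Z W p
  proof -
    note raise1 = raise_index_vfield[OF mf met parallel_smooth[OF assms(3)]]
    note raise2 = raise_index_vfield[OF mf met parallel_smooth[OF assms(4)]]
    note T = smooth_vfield_in_tangent_space
    note nab = affine_connection_smooth[OF conn Y]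
    obtain Z1 where Z1: "smooth_vfield A Z1"
      "\<And>p. p \<in> topspace X \<Longrightarrow> \<forall>w\<in>tangent_space A p. g p (Z1 p) w = \<omega> 1 p (Z p) w"
      by (rule raise1[OF Z]) (rule that)
    obtain Z2 where Z2: "smooth_vfield A Z2"
      "\<And>p. p \<in> topspace X \<Longrightarrow> \<forall>w\<in>tangent_space A p. g p (Z2 p) w = \<omega> 2 p (Z p) w"
      by (rule raise2[OF Z]) (rule that)
    obtain W1 where W1: "smooth_vfield A W1"
      "\<And>p. p \<in> topspace X \<Longrightarrow> \<forall>w\<in>tangent_space A p. g p (W1 p) w = \<omega> 1 p (W p) w"
      by (rule raise1[OF W]) (rule that)
    obtain W2 where W2: "smooth_vfield A W2"
      "\<And>p. p \<in> topspace X \<Longrightarrow> \<forall>w\<in>tangent_space A p. g p (W2 p) w = \<omega> 2 p (W p) w"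
      by (rule raise2[OF W]) (rule that)
    note commute1 = connection_commutes_with_raised_index[OF mf met conn gpar assms(3) Y]
    note commute2 = connection_commutes_with_raised_index[OF mf met conn gpar assms(4) Y]
    \<comment> \<open>Thus \<open>nabla Y Z1\<close> is raised from \<open>nabla Y Z\<close>, and
      similarly for the other three, which makes the formula for the dualizing form applicable to
      covariant derivatives.\<close>
    note dZ1 = commute1[OF Z Z1 p] and dZ2 = commute2[OF Z Z2 p]
    note dW1 = commute1[OF W W1 p] and dW2 = commute2[OF W W2 p]
    have "dir_deriv A p (Y p) (\<lambda>q. ?\<omega>D q (Z q) (W q))
      = dir_deriv A p (Y p) (\<lambda>q. g q (Z1 q) (W2 q) - g q (Z2 q) (W1 q))"
    proof (rule dir_deriv_cong[OF mf p])
      show "?\<omega>D q (Z q) (W q) = g q (Z1 q) (W2 q) - g q (Z2 q) (W1 q)" if q: "q \<in> topspace X" for q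
        by (rule dualizing_form_eq[OF ak q T[OF Z] T[OF W] T[OF Z1(1)] Z1(2)[OF q] T[OF Z2(1)] Z2(2)[OF q]
              T[OF W1(1)] W1(2)[OF q] T[OF W2(1)] W2(2)[OF q]])
    qed
    also have "\<dots> = g p (nabla Y Z1 p) (W2 p) + g p (Z1 p) (nabla Y W2 p)
        - (g p (nabla Y Z2 p) (W1 p) + g p (Z2 p) (nabla Y W1 p))"
      unfolding dir_deriv_diff[OF mf p smooth_fun_bilinear_field[OF mf g Z1(1) W2(1)]
          smooth_fun_bilinear_field[OF mf g Z2(1) W1(1)]]
        parallel_dir_deriv[OF gpar Y Z1(1) W2(1) p] parallel_dir_deriv[OF gpar Y Z2(1) W1(1) p] ..
    finally have D: "dir_deriv A p (Y p) (\<lambda>q. ?\<omega>D q (Z q) (W q)) = \<dots>" .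
    \<comment> \<open>The four terms of \<open>D\<close> are regrouped by the field that is
      differentiated: those with a derivative of \<open>Z1\<close> or \<open>Z2\<close> form this
      value, those with a derivative of \<open>W1\<close> or \<open>W2\<close> the next.\<close>
    have "?\<omega>D p (nabla Y Z p) (W p) = g p (nabla Y Z1 p) (W2 p) - g p (nabla Y Z2 p) (W1 p)"
      by (rule dualizing_form_eq[OF ak p T[OF nab[OF Z]] T[OF W] T[OF nab[OF Z1(1)]] dZ1
            T[OF nab[OF Z2(1)]] dZ2 T[OF W1(1)] W1(2)[OF p] T[OF W2(1)] W2(2)[OF p]])
    moreover have "?\<omega>D p (Z p) (nabla Y W p) = g p (Z1 p) (nabla Y W2 p) - g p (Z2 p) (nabla Y W1 p)"
      by (rule dualizing_form_eq[OF ak p T[OF Z] T[OF nab[OF W]] T[OF Z1(1)] Z1(2)[OF p]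
            T[OF Z2(1)] Z2(2)[OF p] T[OF nab[OF W1(1)]] dW1 T[OF nab[OF W2(1)]] dW2])
    ultimately show ?thesis unfolding cov_deriv_def D by linarith
  qed
  note two = two_form_dualizing_form[OF ak]
  have par: "parallel X A nabla ?\<omega>D"
    unfolding parallel_def
  proof (intro conjI allI impI ballI)
    show "smooth_bilinear_field X A ?\<omega>D"
      using two unfolding two_form_def by (rule conjunct1)
  qed (elim conjE, rule flat)
  with parallel_two_form_closed[OF mf conn tors par two] show ?thesis
    unfolding weakly_self_dual_def by blast
qed

end
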